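(* \begin{enumerate} \item There exists a linear threshold function $f:\{-1,1\}^n\to\{-1,1\}$ and an absolute constant $c>0$ such that $\mathsf{PP}(f\circ\mathsf{XOR})\ge cn$. \item $\mathsf{PP}(\mathsf{GHR})\ge\Omega(\sqrt n)$, where $n$ is the number of input variables of the universal threshold function underlying $\mathsf{GHR}$. \end{enumerate}
   Context: A linear threshold function is $f(x)=\mathrm{sgn}(\sum_i w_ix_i)$ for real (integer) weights with the sum never zero. $(f\circ\mathsf{XOR})(x,y)=f(x_1y_1,\dots,x_ny_n)$ with Alice holding $x$ and Bob $y$. The universal threshold function $U_{l,k}:(\{-1,1\}^k)^l\to\{-1,1\}$ is $U_{l,k}(x)=\mathrm{sgn}\big(\sum_{i=1}^k\sum_{j=1}^l 2^ix_{i,j}+\tfrac12\big)$; it is universal in that every linear threshold function on $N$ variables is a subfunction of $U_{l,k}$ for some $l,k\in O(N\log N)$. The $\mathsf{GHR}$ function is $\mathsf{UTHR}\circ\mathsf{XOR}$, i.e. $U_{l,k}\circ\mathsf{XOR}$ (e.g. $U_{4m,m}\circ\mathsf{XOR}$), with $n=lk$ inner variables. For a two-party $G$, $R_\epsilon(G)$ is the minimum cost of a private-coin protocol correct with probability $\ge1/2+\epsilon$ on every input, and $\mathsf{PP}(G)=\min_{\epsilon>0}(R_\epsilon(G)+\log(1/\epsilon))$. *)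

theory Defs
  imports "HOL-Probability.Probability" "HOL-Library.Landau_Symbols"
begin

text \<open>
  Points of the sign cube over an index set are extensional functions, so that the elements of
  \<open>sign_cube I\<close> correspond one-to-one to sign vectors indexed by \<open>I\<close>.
\<close>

definition sign_cube :: "'i set \<Rightarrow> ('i \<Rightarrow> real) set" where
  "sign_cube I = I \<rightarrow>\<^sub>E {-1, 1}"

definition linear_threshold :: "'i set \<Rightarrow> (('i \<Rightarrow> real) \<Rightarrow> real) \<Rightarrow> bool" where
  "linear_threshold I f \<longleftrightarrow>
     (\<exists>w :: 'i \<Rightarrow> real. \<forall>x \<in> sign_cube I.
        (\<Sum>i\<in>I. w i * x i) \<noteq> 0 \<and> f x = sgn (\<Sum>i\<in>I. w i * x i))"

text \<open>On the values \<open>-1\<close> and \<open>1\<close>, XOR of two bits is their product.\<close>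

definition comp_xor ::
    "'i set \<Rightarrow> (('i \<Rightarrow> real) \<Rightarrow> real) \<Rightarrow> ('i \<Rightarrow> real) \<Rightarrow> ('i \<Rightarrow> real) \<Rightarrow> real" where
  "comp_xor I f x y = f (\<lambda>i\<in>I. x i * y i)"

definition uthr_index :: "nat \<Rightarrow> nat \<Rightarrow> (nat \<times> nat) set" where
  "uthr_index l k = {1..k} \<times> {1..l}"

definition uthr :: "nat \<Rightarrow> nat \<Rightarrow> (nat \<times> nat \<Rightarrow> real) \<Rightarrow> real" where
  "uthr l k x = sgn ((\<Sum>i=1..k. \<Sum>j=1..l. 2 ^ i * x (i, j)) + 1 / 2)"

text \<open>
  Deterministic protocol trees. At an \<open>Alice\<close> (\<open>Bob\<close>) node the owner sends one bit, which is
  a function of what that party sees; the protocol continues in the first subtree if the bit is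
  \<^const>\<open>True\<close> and in the second one otherwise.
\<close>

datatype ('a, 'b, 'o) protocol =
    Output 'o
  | Alice "'a \<Rightarrow> bool" "('a, 'b, 'o) protocol" "('a, 'b, 'o) protocol"
  | Bob "'b \<Rightarrow> bool" "('a, 'b, 'o) protocol" "('a, 'b, 'o) protocol"

primrec run :: "('a, 'b, 'o) protocol \<Rightarrow> 'a \<Rightarrow> 'b \<Rightarrow> 'o" where
  "run (Output c) a b = c"
| "run (Alice s P Q) a b = (if s a then run P a b else run Q a b)"
| "run (Bob s P Q) a b = (if s b then run P a b else run Q a b)"

primrec cost :: "('a, 'b, 'o) protocol \<Rightarrow> nat" where
  "cost (Output c) = 0"
| "cost (Alice s P Q) = 1 + max (cost P) (cost Q)"
| "cost (Bob s P Q) = 1 + max (cost P) (cost Q)"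

text \<open>
  A private-coin protocol is a protocol tree in which each party sees, besides the own input,
  an own random string; the two strings are drawn independently from \<open>\<mu>\<close> and \<open>\<nu>\<close>.
\<close>

definition private_coin_computes ::
    "real \<Rightarrow> 'a set \<Rightarrow> 'b set \<Rightarrow> ('a \<Rightarrow> 'b \<Rightarrow> 'o) \<Rightarrow>
     bool list pmf \<Rightarrow> bool list pmf \<Rightarrow> ('a \<times> bool list, 'b \<times> bool list, 'o) protocol \<Rightarrow> bool"
  where
  "private_coin_computes \<epsilon> X Y G \<mu> \<nu> P \<longleftrightarrow>
     (\<forall>x\<in>X. \<forall>y\<in>Y.
        measure_pmf.prob (pair_pmf \<mu> \<nu>) {(r, s). run P (x, r) (y, s) = G x y} \<ge> 1 / 2 + \<epsilon>)"

definition R_comm :: "real \<Rightarrow> 'a set \<Rightarrow> 'b set \<Rightarrow> ('a \<Rightarrow> 'b \<Rightarrow> 'o) \<Rightarrow> nat" where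
  "R_comm \<epsilon> X Y G = (LEAST d. \<exists>\<mu> \<nu> P. private_coin_computes \<epsilon> X Y G \<mu> \<nu> P \<and> cost P = d)"

text \<open>
  Advantages above \<open>1 / 2\<close> are excluded because no protocol attains them; for \<open>\<epsilon> \<le> 1 / 2\<close> and
  finite \<open>X\<close>, \<open>Y\<close> a protocol always exists, so \<open>R_comm\<close> is a genuine minimum.
\<close>

definition PP_comm :: "'a set \<Rightarrow> 'b set \<Rightarrow> ('a \<Rightarrow> 'b \<Rightarrow> 'o) \<Rightarrow> real" where
  "PP_comm X Y G = (INF \<epsilon>\<in>{0<..1 / 2}. real (R_comm \<epsilon> X Y G) + log 2 (1 / \<epsilon>))"

definition PP_xor :: "'i set \<Rightarrow> (('i \<Rightarrow> real) \<Rightarrow> real) \<Rightarrow> real" where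
  "PP_xor I f = PP_comm (sign_cube I) (sign_cube I) (comp_xor I f)"

end

theory Submission imports Defs begin

text \<open>
  By the discrepancy method, it suffices to find a signed measure \<open>h\<close> on the sign cube that agrees
  in sign with \<open>f\<close> and whose correlation with every character is exponentially small compared to
  its mass. For a halfspace with linear form \<open>V\<close> one takes the difference of the indicators of
  \<open>V = t\<close> and \<open>V = t - 4\<close>, where the level \<open>t\<close> is popular and the threshold lies just below it.
  The discrete Fourier transform expresses the correlations through the products of the factors
  \<open>cos (\<theta> u\<^sub>i)\<close> and \<open>sin (\<theta> u\<^sub>i)\<close>. If \<open>4\<theta>\<close> is close to an integer (in units of \<open>2\<pi>\<close>), then the
  two indicators nearly cancel, and few frequencies are of this kind; otherwise the product is
  exponentially small, for random weights of \<open>\<Theta>(n)\<close> bits as well as for the weights \<open>2\<^sup>i\<close> with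
  multiplicity proportional to the number of bits. The shift is \<open>4\<close> because the
  character on the coordinates of odd weight determines \<open>V\<close> modulo \<open>4\<close>.
\<close>

subsection \<open>Discrepancy\<close>

text \<open>Once the coins \<open>r\<close> and \<open>s\<close> are fixed, each message splits the
  rectangle along the side of its owner into two rectangles, handled by the two subtrees. At a leaf
  \<open>v\<close> is a constant of modulus at most 1, so \<open>rect\<close> applies; there are at
  most \<open>2 ^ cost P\<close> leaves.\<close>

lemma protocol_discrepancy:
  fixes H :: "'a \<Rightarrow> 'b \<Rightarrow> real" and v :: "'o \<Rightarrow> real"
  assumes X: "finite X" and Y: "finite Y"
    and rect: "\<And>A B. A \<subseteq> X \<Longrightarrow> B \<subseteq> Y \<Longrightarrow> \<bar>\<Sum>x\<in>A. \<Sum>y\<in>B. H x y\<bar> \<le> \<Delta>"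
    and v: "\<And>c. \<bar>v c\<bar> \<le> 1"
    and "A \<subseteq> X" "B \<subseteq> Y"
  shows "\<bar>\<Sum>x\<in>A. \<Sum>y\<in>B. H x y * v (run P (x, r) (y, s))\<bar> \<le> 2 ^ cost P * \<Delta>"
  using \<open>A \<subseteq> X\<close> \<open>B \<subseteq> Y\<close>
proof (induction P arbitrary: A B)
  case (Output c)
  have "\<bar>\<Sum>x\<in>A. \<Sum>y\<in>B. H x y * v c\<bar> = \<bar>\<Sum>x\<in>A. \<Sum>y\<in>B. H x y\<bar> * \<bar>v c\<bar>"
    by (simp add: sum_distrib_right[symmetric] abs_mult)
  also have "\<dots> \<le> \<Delta> * 1"
    using rect[OF Output] v[of c] by (intro mult_mono) auto
  finally show ?case by simp
next
  case (Alice p P Q)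
  let ?A = "{x\<in>A. p (x, r)}" and ?A' = "{x\<in>A. \<not> p (x, r)}"
  have fin: "finite A" using Alice.prems X finite_subset by blast
  have \<Delta>: "0 \<le> \<Delta>" using rect[of "{}" "{}"] by simp
  have "A = ?A \<union> ?A'" by auto
  then have "(\<Sum>x\<in>A. \<Sum>y\<in>B. H x y * v (run (Alice p P Q) (x, r) (y, s))) =
      (\<Sum>x\<in>?A \<union> ?A'. \<Sum>y\<in>B. H x y * v (run (Alice p P Q) (x, r) (y, s)))" by simp
  also have "\<dots> = (\<Sum>x\<in>?A. \<Sum>y\<in>B. H x y * v (run P (x, r) (y, s)))
      + (\<Sum>x\<in>?A'. \<Sum>y\<in>B. H x y * v (run Q (x, r) (y, s)))"
    using fin by (subst sum.union_disjoint) auto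
  finally have "\<bar>\<Sum>x\<in>A. \<Sum>y\<in>B. H x y * v (run (Alice p P Q) (x, r) (y, s))\<bar>
      \<le> 2 ^ cost P * \<Delta> + 2 ^ cost Q * \<Delta>"
    using Alice.IH(1)[of ?A B] Alice.IH(2)[of ?A' B] Alice.prems by force
  also have "\<dots> \<le> 2 ^ max (cost P) (cost Q) * \<Delta> + 2 ^ max (cost P) (cost Q) * \<Delta>"
    using \<Delta> by (intro add_mono mult_right_mono) auto
  finally show ?case by (simp add: mult_ac)
next
  case (Bob p P Q)
  let ?B = "{y\<in>B. p (y, s)}" and ?B' = "{y\<in>B. \<not> p (y, s)}"
  have fin: "finite B" using Bob.prems Y finite_subset by blast
  have \<Delta>: "0 \<le> \<Delta>" using rect[of "{}" "{}"] by simp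
  have split: "(\<Sum>y\<in>B. H x y * v (run (Bob p P Q) (x, r) (y, s))) =
      (\<Sum>y\<in>?B. H x y * v (run P (x, r) (y, s))) + (\<Sum>y\<in>?B'. H x y * v (run Q (x, r) (y, s)))"
    for x
  proof -
    have "B = ?B \<union> ?B'" by auto
    then have "(\<Sum>y\<in>B. H x y * v (run (Bob p P Q) (x, r) (y, s))) =
      (\<Sum>y\<in>?B \<union> ?B'. H x y * v (run (Bob p P Q) (x, r) (y, s)))" by simp
    also have "\<dots> = (\<Sum>y\<in>?B. H x y * v (run P (x, r) (y, s)))
      + (\<Sum>y\<in>?B'. H x y * v (run Q (x, r) (y, s)))"
      using fin by (subst sum.union_disjoint) auto
    finally show ?thesis .
  qed
  have "\<bar>\<Sum>x\<in>A. \<Sum>y\<in>B. H x y * v (run (Bob p P Q) (x, r) (y, s))\<bar>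
      \<le> 2 ^ cost P * \<Delta> + 2 ^ cost Q * \<Delta>"
    unfolding split sum.distrib
    using Bob.IH(1)[of A ?B] Bob.IH(2)[of A ?B'] Bob.prems by force
  also have "\<dots> \<le> 2 ^ max (cost P) (cost Q) * \<Delta> + 2 ^ max (cost P) (cost Q) * \<Delta>"
    using \<Delta> by (intro add_mono mult_right_mono) auto
  finally show ?case by (simp add: mult_ac)
qed

text \<open>The expected sign of the output is correlated with \<open>G\<close> by at least
  \<open>2 * \<epsilon>\<close> at every input where \<open>H\<close> is nonzero. Weighting by
  \<open>H\<close>, summing and exchanging sum and expectation leaves a quantity that
  \<open>protocol_discrepancy\<close> bounds for each fixed pair of coin strings.\<close>

lemma private_coin_discrepancy:
  fixes H :: "'a \<Rightarrow> 'b \<Rightarrow> real" and G :: "'a \<Rightarrow> 'b \<Rightarrow> real"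
  assumes X: "finite X" and Y: "finite Y"
    and rect: "\<And>A B. A \<subseteq> X \<Longrightarrow> B \<subseteq> Y \<Longrightarrow> \<bar>\<Sum>x\<in>A. \<Sum>y\<in>B. H x y\<bar> \<le> \<Delta>"
    and sign: "\<And>x y. x \<in> X \<Longrightarrow> y \<in> Y \<Longrightarrow> H x y * G x y = \<bar>H x y\<bar>"
    and comp: "private_coin_computes \<epsilon> X Y G \<mu> \<nu> P"
  shows "2 * \<epsilon> * (\<Sum>x\<in>X. \<Sum>y\<in>Y. \<bar>H x y\<bar>) \<le> 2 ^ cost P * \<Delta>"
proof -
  \<comment> \<open>Outputs are arbitrary reals; every output other than 1 is read as -1.\<close>
  define v :: "real \<Rightarrow> real" where "v c = (if c = 1 then 1 else - 1)" for c
  have v: "\<bar>v c\<bar> \<le> 1" for c by (simp add: v_def)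
  let ?M = "measure_pmf (pair_pmf \<mu> \<nu>)"
  let ?F = "\<lambda>x y \<omega>. v (run P (x, fst \<omega>) (y, snd \<omega>))"
  have int: "integrable ?M (\<lambda>\<omega>. v (g \<omega>))" for g
    by (intro measure_pmf.integrable_const_bound[where B = 1] AE_I2) (simp_all add: v)
  have pt: "2 * \<epsilon> * \<bar>H x y\<bar> \<le> H x y * measure_pmf.expectation (pair_pmf \<mu> \<nu>) (?F x y)"
    if xy: "x \<in> X" "y \<in> Y" for x y
  proof (cases "H x y = 0")
    case False
    then have "G x y = \<bar>H x y\<bar> / H x y" using sign[OF xy] by (simp add: field_simps)
    \<comment> \<open>The hypothesis \<open>sign\<close> forces \<open>G\<close> to be a sign where
      \<open>H\<close> does not vanish; elsewhere no value of \<open>G\<close> matters.\<close>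
    with False have G: "G x y = 1 \<or> G x y = - 1" by (auto simp: abs_if)
    let ?E = "{\<omega>. run P (x, fst \<omega>) (y, snd \<omega>) = G x y}"
    have prob: "1 / 2 + \<epsilon> \<le> measure ?M ?E"
      using comp xy unfolding private_coin_computes_def by (simp add: case_prod_beta')
    have "2 * \<epsilon> \<le> (\<integral>\<omega>. 2 * indicator ?E \<omega> - 1 \<partial>?M)"
      using prob by (subst Bochner_Integration.integral_diff)
        (auto simp: measure_pmf.emeasure_eq_measure)
    \<comment> \<open>The integrands agree on \<open>?E\<close>. Off \<open>?E\<close> the left one
      is -1, whereas a wrong output may still be rounded by \<open>v\<close> to the correct sign, so
      only an inequality holds.\<close>
    also have "\<dots> \<le> (\<integral>\<omega>. G x y * ?F x y \<omega> \<partial>?M)"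
    proof (rule integral_mono)
      show "integrable ?M (\<lambda>\<omega>. 2 * indicator ?E \<omega> - 1 :: real)"
        by (intro Bochner_Integration.integrable_diff integrable_mult_right)
          (auto simp: measure_pmf.emeasure_eq_measure)
      show "integrable ?M (\<lambda>\<omega>. G x y * ?F x y \<omega>)"
        by (intro integrable_mult_right int)
    qed (use G in \<open>auto simp: v_def indicator_def\<close>)
    finally have "2 * \<epsilon> \<le> G x y * measure_pmf.expectation (pair_pmf \<mu> \<nu>) (?F x y)"
      by simp
    then have "\<bar>H x y\<bar> * (2 * \<epsilon>) \<le> \<bar>H x y\<bar> * (G x y * measure_pmf.expectation (pair_pmf \<mu> \<nu>) (?F x y))"
      by (intro mult_left_mono) auto
    also have "\<dots> = (\<bar>H x y\<bar> * G x y) * measure_pmf.expectation (pair_pmf \<mu> \<nu>) (?F x y)"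
      by (rule mult.assoc[symmetric])
    also have "\<bar>H x y\<bar> * G x y = H x y"
      using sign[OF xy, symmetric] G by auto
    finally show ?thesis by (simp only: mult_ac)
  qed simp
  have "2 * \<epsilon> * (\<Sum>x\<in>X. \<Sum>y\<in>Y. \<bar>H x y\<bar>) = (\<Sum>x\<in>X. \<Sum>y\<in>Y. 2 * \<epsilon> * \<bar>H x y\<bar>)"
    by (simp add: sum_distrib_left)
  also have "\<dots> \<le> (\<Sum>x\<in>X. \<Sum>y\<in>Y. H x y * measure_pmf.expectation (pair_pmf \<mu> \<nu>) (?F x y))"
    by (intro sum_mono pt)
  also have "\<dots> = (\<integral>\<omega>. (\<Sum>x\<in>X. \<Sum>y\<in>Y. H x y * ?F x y \<omega>) \<partial>?M)"
    by (simp add: Bochner_Integration.integral_sum Bochner_Integration.integrable_sum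
        integrable_mult_right int)
  also have "\<dots> \<le> (\<integral>\<omega>. 2 ^ cost P * \<Delta> \<partial>?M)"
  proof (rule integral_mono)
    show "(\<Sum>x\<in>X. \<Sum>y\<in>Y. H x y * ?F x y \<omega>) \<le> 2 ^ cost P * \<Delta>" for \<omega>
      by (rule order.trans[OF abs_ge_self], rule protocol_discrepancy[OF X Y])
        (auto intro: rect v)
  qed (auto intro!: Bochner_Integration.integrable_sum integrable_mult_right int)
  also have "\<dots> = 2 ^ cost P * \<Delta>" by simp
  finally show ?thesis .
qed

section \<open>Existence of optimal protocols and bounds for \<open>PP_comm\<close>\<close>

text \<open>Alice is asked about the elements of \<open>X\<close> one by one, then Bob about those
  of \<open>Y\<close>. The cost is irrelevant: the protocol only shows that the \<open>LEAST\<close>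
  in \<open>R_comm\<close> ranges over a nonempty set.\<close>

lemma exists_deterministic_protocol:
  assumes "finite X" "finite Y"
  shows "\<exists>P :: ('a \<times> 'r, 'b \<times> 's, 'o) protocol. \<forall>x\<in>X. \<forall>y\<in>Y. \<forall>r s. run P (x, r) (y, s) = G x y"
  using \<open>finite X\<close>
proof induction
  case (insert a X)
  have "\<exists>P :: ('a \<times> 'r, 'b \<times> 's, 'o) protocol. \<forall>y\<in>Y. \<forall>u s. run P u (y, s) = G a y"
    using \<open>finite Y\<close>
  proof induction
    case (insert b Y)
    then obtain P :: "('a \<times> 'r, 'b \<times> 's, 'o) protocol" where "\<forall>y\<in>Y. \<forall>u s. run P u (y, s) = G a y" by blast
    then show ?case
      by (intro exI[of _ "Bob (\<lambda>u. fst u = b) (Output (G a b)) P"]) auto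
  qed simp
  then obtain Pa :: "('a \<times> 'r, 'b \<times> 's, 'o) protocol" where "\<forall>y\<in>Y. \<forall>u s. run Pa u (y, s) = G a y" by blast
  moreover obtain P :: "('a \<times> 'r, 'b \<times> 's, 'o) protocol" where "\<forall>x\<in>X. \<forall>y\<in>Y. \<forall>r s. run P (x, r) (y, s) = G x y"
    using insert.IH by blast
  ultimately show ?case
    by (intro exI[of _ "Alice (\<lambda>u. fst u = a) Pa P"]) auto
qed simp

lemma R_comm_attained:
  assumes "finite X" "finite Y" "\<epsilon> \<le> 1 / 2"
  obtains \<mu> \<nu> P where "private_coin_computes \<epsilon> X Y G \<mu> \<nu> P" "cost P = R_comm \<epsilon> X Y G"
proof -
  obtain P :: "('a \<times> bool list, 'b \<times> bool list, 'c) protocol"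
    where P: "\<forall>x\<in>X. \<forall>y\<in>Y. \<forall>r s. run P (x, r) (y, s) = G x y"
    using exists_deterministic_protocol[OF assms(1,2), of G] by (elim exE)
  have "private_coin_computes \<epsilon> X Y G \<mu> \<nu> P" for \<mu> \<nu>
    unfolding private_coin_computes_def
  proof (intro ballI)
    fix x y assume "x \<in> X" "y \<in> Y"
    then have "{(r, s). run P (x, r) (y, s) = G x y} = UNIV" by (simp add: P)
    then show "1 / 2 + \<epsilon> \<le> measure_pmf.prob (pair_pmf \<mu> \<nu>) {(r, s). run P (x, r) (y, s) = G x y}"
      using assms(3) by simp
  qed
  then have "\<exists>\<mu> \<nu> P'. private_coin_computes \<epsilon> X Y G \<mu> \<nu> P' \<and> cost P' = cost P" by blast
  then have "\<exists>\<mu> \<nu> P. private_coin_computes \<epsilon> X Y G \<mu> \<nu> P \<and> cost P = R_comm \<epsilon> X Y G"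
    unfolding R_comm_def by (rule LeastI)
  with that show thesis by blast
qed

lemma PP_comm_ge_log_discrepancy:
  fixes H :: "'a \<Rightarrow> 'b \<Rightarrow> real" and G :: "'a \<Rightarrow> 'b \<Rightarrow> real"
  assumes X: "finite X" and Y: "finite Y"
    and rect: "\<And>A B. A \<subseteq> X \<Longrightarrow> B \<subseteq> Y \<Longrightarrow> \<bar>\<Sum>x\<in>A. \<Sum>y\<in>B. H x y\<bar> \<le> \<delta> * (\<Sum>x\<in>X. \<Sum>y\<in>Y. \<bar>H x y\<bar>)"
    and sign: "\<And>x y. x \<in> X \<Longrightarrow> y \<in> Y \<Longrightarrow> H x y * G x y = \<bar>H x y\<bar>"
    and pos: "0 < (\<Sum>x\<in>X. \<Sum>y\<in>Y. \<bar>H x y\<bar>)" and \<delta>: "0 < \<delta>"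
  shows "log 2 (1 / \<delta>) \<le> PP_comm X Y G"
  unfolding PP_comm_def
proof (rule cINF_greatest)
  fix \<epsilon> :: real assume \<epsilon>: "\<epsilon> \<in> {0<..1 / 2}"
  then obtain \<mu> \<nu> P where P: "private_coin_computes \<epsilon> X Y G \<mu> \<nu> P" "cost P = R_comm \<epsilon> X Y G"
    using R_comm_attained[OF X Y, of \<epsilon> G] by auto
  let ?d = "R_comm \<epsilon> X Y G"
  have "2 * \<epsilon> * (\<Sum>x\<in>X. \<Sum>y\<in>Y. \<bar>H x y\<bar>) \<le> 2 ^ ?d * \<delta> * (\<Sum>x\<in>X. \<Sum>y\<in>Y. \<bar>H x y\<bar>)"
    using private_coin_discrepancy[OF X Y rect sign P(1)] P(2) by (simp add: mult.assoc)
  then have "2 * \<epsilon> \<le> 2 ^ ?d * \<delta>" using pos by simp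
  \<comment> \<open>A factor 2 is given away here, that is, one bit in the final bound.\<close>
  then have "1 / \<delta> \<le> 2 ^ ?d * (1 / \<epsilon>)" using \<epsilon> \<delta> by (simp add: field_simps)
  then have "log 2 (1 / \<delta>) \<le> log 2 (2 ^ ?d * (1 / \<epsilon>))"
    using \<delta> \<epsilon> by (subst log_le_cancel_iff) auto
  also have "\<dots> = real ?d + log 2 (1 / \<epsilon>)" using \<epsilon> by (subst log_mult) auto
  finally show "log 2 (1 / \<delta>) \<le> real ?d + log 2 (1 / \<epsilon>)" .
qed simp

text \<open>The term \<open>log 2 (1 / \<epsilon>)\<close> alone is at least 1. This absorbs the
  additive constants of the later bounds for small parameters.\<close>

lemma PP_comm_ge_1: "1 \<le> PP_comm X Y G"
  unfolding PP_comm_def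
proof (rule cINF_greatest)
  fix \<epsilon> :: real assume "\<epsilon> \<in> {0<..1 / 2}"
  then have "log 2 2 \<le> log 2 (1 / \<epsilon>)" by (subst log_le_cancel_iff) (auto simp: field_simps)
  then show "1 \<le> real (R_comm \<epsilon> X Y G) + log 2 (1 / \<epsilon>)" by simp
qed simp

subsection \<open>Discrepancy of XOR functions\<close>

lemma finite_sign_cube: "finite I \<Longrightarrow> finite (sign_cube I)"
  by (simp add: sign_cube_def finite_PiE)

lemma card_sign_cube: "finite I \<Longrightarrow> card (sign_cube I) = 2 ^ card I"
  by (simp add: sign_cube_def card_PiE numeral_2_eq_2)

lemma sign_cubeD: "z \<in> sign_cube I \<Longrightarrow> i \<in> I \<Longrightarrow> z i = - 1 \<or> z i = 1"
  by (auto simp: sign_cube_def dest: PiE_mem)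

lemma sign_cube_square: "z \<in> sign_cube I \<Longrightarrow> i \<in> I \<Longrightarrow> z i * z i = 1"
  using sign_cubeD[of z I i] by auto

definition character :: "'i set \<Rightarrow> ('i \<Rightarrow> real) \<Rightarrow> real" where
  "character S z = (\<Prod>i\<in>S. z i)"

text \<open>The sum over all subsets is the expansion of the product of
  \<open>x i * y i + 1\<close>, in which any coordinate where \<open>x\<close> and \<open>y\<close>
  differ gives a zero factor.\<close>

lemma character_orthogonal:
  assumes "finite I" "x \<in> sign_cube I" "y \<in> sign_cube I"
  shows "(\<Sum>S\<in>Pow I. character S x * character S y) = (if x = y then 2 ^ card I else 0)"
proof -
  have "(\<Sum>S\<in>Pow I. character S x * character S y) = (\<Prod>i\<in>I. x i * y i + 1)"
    by (simp add: prod_add[OF assms(1)] character_def prod.distrib)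
  also have "\<dots> = (if x = y then 2 ^ card I else 0)"
  proof (cases "x = y")
    case True
    then show ?thesis using sign_cube_square[OF assms(2)] by simp
  next
    case False
    then obtain i where i: "i \<in> I" "x i \<noteq> y i"
      using assms(2,3) unfolding sign_cube_def by (meson PiE_ext)
    then have "x i * y i + 1 = 0"
      using sign_cubeD[OF assms(2), of i] sign_cubeD[OF assms(3), of i] by auto
    with False i assms(1) show ?thesis by (auto intro: prod_zero)
  qed
  finally show ?thesis .
qed

text \<open>Parseval for the indicator of \<open>A\<close>: the sum equals
  \<open>card A * 2 ^ card I\<close>.\<close>

lemma sum_character_squares_le:
  assumes "finite I" "A \<subseteq> sign_cube I"
  shows "(\<Sum>S\<in>Pow I. (\<Sum>x\<in>A. character S x)\<^sup>2) \<le> 2 ^ card I * 2 ^ card I"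
proof -
  have fin: "finite A" using assms finite_sign_cube finite_subset by blast
  have "(\<Sum>S\<in>Pow I. (\<Sum>x\<in>A. character S x)\<^sup>2)
      = (\<Sum>S\<in>Pow I. \<Sum>x\<in>A. \<Sum>y\<in>A. character S x * character S y)"
    by (simp add: power2_eq_square sum_product)
  also have "\<dots> = (\<Sum>x\<in>A. \<Sum>S\<in>Pow I. \<Sum>y\<in>A. character S x * character S y)"
    by (rule sum.swap)
  also have "\<dots> = (\<Sum>x\<in>A. \<Sum>y\<in>A. \<Sum>S\<in>Pow I. character S x * character S y)"
    by (intro sum.cong refl sum.swap)
  also have "\<dots> = (\<Sum>x\<in>A. \<Sum>y\<in>A. if x = y then 2 ^ card I else 0)"
    by (intro sum.cong refl character_orthogonal assms(1)) (use assms(2) in auto)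
  also have "\<dots> = real (card A) * 2 ^ card I" using fin by simp
  also have "\<dots> \<le> 2 ^ card I * 2 ^ card I"
    using card_mono[OF finite_sign_cube[OF assms(1)] assms(2)] card_sign_cube[OF assms(1)]
    by (intro mult_right_mono) (simp_all add: numeral_power_le_of_nat_cancel_iff)
  finally show ?thesis .
qed

lemma xor_in_sign_cube:
  assumes "x \<in> sign_cube I" "y \<in> sign_cube I"
  shows "(\<lambda>i\<in>I. x i * y i) \<in> sign_cube I"
  using sign_cubeD[OF assms(1)] sign_cubeD[OF assms(2)] unfolding sign_cube_def by fastforce

text \<open>The characters diagonalize the matrix with entries
  \<open>h (\<lambda>i\<in>I. x i * y i)\<close>, since a character of a product factors. After
  Fourier inversion the rectangle sum becomes a sum over \<open>S\<close> of
  \<open>F S * (a S * b S)\<close>, bounded by the maximum of \<open>F\<close> and Parseval for both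
  sides of the rectangle.\<close>

lemma xor_rectangle_bound:
  fixes h :: "('i \<Rightarrow> real) \<Rightarrow> real"
  assumes I: "finite I" and A: "A \<subseteq> sign_cube I" and B: "B \<subseteq> sign_cube I"
    and D: "\<And>S. S \<subseteq> I \<Longrightarrow> \<bar>\<Sum>z\<in>sign_cube I. h z * character S z\<bar> \<le> D"
  shows "\<bar>\<Sum>x\<in>A. \<Sum>y\<in>B. h (\<lambda>i\<in>I. x i * y i)\<bar> \<le> 2 ^ card I * D"
proof -
  let ?C = "sign_cube I" and ?N = "2 ^ card I :: real"
  define F where "F S = (\<Sum>z\<in>?C. h z * character S z)" for S
  define a where "a S = (\<Sum>x\<in>A. character S x)" for S
  define b where "b S = (\<Sum>y\<in>B. character S y)" for S
  have inv: "?N * h z = (\<Sum>S\<in>Pow I. F S * character S z)" if z: "z \<in> ?C" for z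
  proof -
    have "(\<Sum>S\<in>Pow I. F S * character S z)
        = (\<Sum>S\<in>Pow I. \<Sum>w\<in>?C. h w * (character S w * character S z))"
      by (simp add: F_def sum_distrib_right mult.assoc)
    also have "\<dots> = (\<Sum>w\<in>?C. \<Sum>S\<in>Pow I. h w * (character S w * character S z))"
      by (rule sum.swap)
    also have "\<dots> = (\<Sum>w\<in>?C. h w * (if w = z then ?N else 0))"
      by (simp add: sum_distrib_left[symmetric] character_orthogonal I z)
    also have "\<dots> = ?N * h z"
      using z finite_sign_cube[OF I] by (simp add: if_distrib cong: if_cong)
    finally show ?thesis by simp
  qed
  have char_xor: "character S (\<lambda>i\<in>I. x i * y i) = character S x * character S y"
    if "S \<subseteq> I" for S x y
    unfolding character_def prod.distrib[symmetric] by (rule prod.cong) (use that in auto)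
  have "?N * (\<Sum>x\<in>A. \<Sum>y\<in>B. h (\<lambda>i\<in>I. x i * y i))
      = (\<Sum>x\<in>A. \<Sum>y\<in>B. \<Sum>S\<in>Pow I. F S * character S (\<lambda>i\<in>I. x i * y i))"
    unfolding sum_distrib_left
    by (intro sum.cong refl inv xor_in_sign_cube) (use A B in auto)
  also have "\<dots> = (\<Sum>x\<in>A. \<Sum>y\<in>B. \<Sum>S\<in>Pow I. F S * (character S x * character S y))"
    by (intro sum.cong refl) (simp add: char_xor)
  also have "\<dots> = (\<Sum>x\<in>A. \<Sum>S\<in>Pow I. \<Sum>y\<in>B. F S * (character S x * character S y))"
    by (intro sum.cong refl sum.swap)
  also have "\<dots> = (\<Sum>S\<in>Pow I. \<Sum>x\<in>A. \<Sum>y\<in>B. F S * (character S x * character S y))"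
    by (rule sum.swap)
  also have "\<dots> = (\<Sum>S\<in>Pow I. F S * (a S * b S))"
    unfolding a_def b_def sum_product by (simp only: sum_distrib_left)
  finally have eq: "?N * (\<Sum>x\<in>A. \<Sum>y\<in>B. h (\<lambda>i\<in>I. x i * y i)) = (\<Sum>S\<in>Pow I. F S * (a S * b S))" .
  have D0: "0 \<le> D" using D[of "{}"] by (meson abs_ge_zero empty_subsetI order_trans)
  have "\<bar>\<Sum>S\<in>Pow I. F S * (a S * b S)\<bar> \<le> (\<Sum>S\<in>Pow I. \<bar>F S * (a S * b S)\<bar>)"
    by (rule sum_abs)
  also have "\<dots> \<le> (\<Sum>S\<in>Pow I. D * (((a S)\<^sup>2 + (b S)\<^sup>2) / 2))"
  proof (rule sum_mono)
    fix S assume "S \<in> Pow I"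
    then have "\<bar>F S\<bar> \<le> D" using D by (simp add: F_def)
    moreover have "\<bar>a S * b S\<bar> \<le> ((a S)\<^sup>2 + (b S)\<^sup>2) / 2"
      using sum_squares_bound[of "\<bar>a S\<bar>" "\<bar>b S\<bar>"] by (simp add: abs_mult)
    ultimately show "\<bar>F S * (a S * b S)\<bar> \<le> D * (((a S)\<^sup>2 + (b S)\<^sup>2) / 2)"
      unfolding abs_mult[of "F S"] using D0 by (intro mult_mono) auto
  qed
  also have "\<dots> = D * (((\<Sum>S\<in>Pow I. (a S)\<^sup>2) + (\<Sum>S\<in>Pow I. (b S)\<^sup>2)) / 2)"
    by (simp add: sum_distrib_left[symmetric] sum_divide_distrib[symmetric] sum.distrib)
  also have "\<dots> \<le> D * ((?N * ?N + ?N * ?N) / 2)"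
    unfolding a_def b_def
    by (intro mult_left_mono divide_right_mono add_mono sum_character_squares_le I A B D0) simp
  finally have "?N * \<bar>\<Sum>x\<in>A. \<Sum>y\<in>B. h (\<lambda>i\<in>I. x i * y i)\<bar> \<le> ?N * (?N * D)"
    unfolding eq[symmetric] by (simp add: abs_mult mult_ac)
  then show ?thesis by simp
qed

text \<open>XOR with a fixed point is an involution of the cube.\<close>

lemma sum_sign_cube_xor:
  assumes "finite I" "x \<in> sign_cube I"
  shows "(\<Sum>y\<in>sign_cube I. g (\<lambda>i\<in>I. x i * y i)) = sum g (sign_cube I)"
proof (rule sum.reindex_bij_witness[where i = "\<lambda>z. \<lambda>i\<in>I. x i * z i" and j = "\<lambda>y. \<lambda>i\<in>I. x i * y i"])
  fix y assume y: "y \<in> sign_cube I"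
  have "(\<lambda>i\<in>I. x i * (\<lambda>i\<in>I. x i * y i) i) = (\<lambda>i\<in>I. y i)"
    by (rule restrict_ext) (simp add: sign_cube_square[OF assms(2)] flip: mult.assoc)
  also have "\<dots> = y" using y unfolding sign_cube_def by (simp add: PiE_restrict)
  finally show "(\<lambda>i\<in>I. x i * (\<lambda>i\<in>I. x i * y i) i) = y" .
  then show "(\<lambda>i\<in>I. x i * (\<lambda>i\<in>I. x i * y i) i) = y" .
qed (use assms in \<open>auto intro: xor_in_sign_cube\<close>)

lemma PP_xor_ge_1: "1 \<le> PP_xor I f"
  unfolding PP_xor_def by (rule PP_comm_ge_1)

text \<open>Lifting \<open>h\<close> to \<open>h (\<lambda>i\<in>I. x i * y i)\<close> multiplies
  the mass by \<open>2 ^ card I\<close>, the same factor as in \<open>xor_rectangle_bound\<close>.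
  The discrepancy is thus at most the largest correlation of \<open>h\<close> with a character
  relative to its mass.\<close>

lemma PP_xor_ge_log_fourier:
  fixes h :: "('i \<Rightarrow> real) \<Rightarrow> real"
  assumes I: "finite I"
    and sign: "\<And>z. z \<in> sign_cube I \<Longrightarrow> h z * f z = \<bar>h z\<bar>"
    and fourier: "\<And>S. S \<subseteq> I \<Longrightarrow>
      \<bar>\<Sum>z\<in>sign_cube I. h z * character S z\<bar> \<le> \<delta> * (\<Sum>z\<in>sign_cube I. \<bar>h z\<bar>)"
    and pos: "0 < (\<Sum>z\<in>sign_cube I. \<bar>h z\<bar>)" and \<delta>: "0 < \<delta>"
  shows "log 2 (1 / \<delta>) \<le> PP_xor I f"
proof -
  let ?C = "sign_cube I" and ?H = "\<lambda>x y. h (\<lambda>i\<in>I. x i * y i)"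
  have total: "(\<Sum>x\<in>?C. \<Sum>y\<in>?C. \<bar>?H x y\<bar>) = 2 ^ card I * (\<Sum>z\<in>?C. \<bar>h z\<bar>)"
    using sum_sign_cube_xor[OF I, where g = "\<lambda>z. \<bar>h z\<bar>"] card_sign_cube[OF I] by simp
  show ?thesis
    unfolding PP_xor_def
  proof (rule PP_comm_ge_log_discrepancy[where H = ?H])
    fix A B assume "A \<subseteq> ?C" "B \<subseteq> ?C"
    then have "\<bar>\<Sum>x\<in>A. \<Sum>y\<in>B. ?H x y\<bar> \<le> 2 ^ card I * (\<delta> * (\<Sum>z\<in>?C. \<bar>h z\<bar>))"
      by (rule xor_rectangle_bound[OF I _ _ fourier])
    then show "\<bar>\<Sum>x\<in>A. \<Sum>y\<in>B. ?H x y\<bar> \<le> \<delta> * (\<Sum>x\<in>?C. \<Sum>y\<in>?C. \<bar>?H x y\<bar>)"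
      unfolding total by (simp add: mult_ac)
  qed (use pos in \<open>auto simp: total finite_sign_cube[OF I] \<delta> comp_xor_def intro: sign xor_in_sign_cube\<close>)
qed

subsection \<open>Level sets of linear forms\<close>

text \<open>
  A bound for both factors at once, hence for all characters, that is affine in \<open>cos (4 * x)\<close> and
  can therefore be averaged over the weights.
\<close>
lemma abs_cos_le: "\<bar>cos x\<bar> \<le> (15 + cos (4 * x)) / 16" and abs_sin_le: "\<bar>sin x\<bar> \<le> (15 + cos (4 * x)) / 16"
  for x :: real
proof -
  have abs_le: "\<bar>c\<bar> \<le> (1 + c\<^sup>2) / 2" for c :: real
    using zero_le_power2[of "\<bar>c\<bar> - 1"] by (simp add: power2_diff)
  have cos4: "cos (4 * x) = 2 * (cos (2 * x))\<^sup>2 - 1"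
    using cos_double_cos[of "2 * x"] by simp
  \<comment> \<open>After \<open>abs_le\<close>, the remaining slack is exactly one eighth of the
    first square for the cosine, and of the second for the sine.\<close>
  have sq: "0 \<le> (1 - cos (2 * x))\<^sup>2" "0 \<le> (1 + cos (2 * x))\<^sup>2" by simp_all
  have "(cos x)\<^sup>2 = (1 + cos (2 * x)) / 2" by (simp add: cos_double_cos)
  then show "\<bar>cos x\<bar> \<le> (15 + cos (4 * x)) / 16"
    using abs_le[of "cos x"] sq unfolding cos4 by (simp add: power2_diff power2_sum field_simps)
  have "(sin x)\<^sup>2 = (1 - cos (2 * x)) / 2" by (simp add: cos_double_sin)
  then show "\<bar>sin x\<bar> \<le> (15 + cos (4 * x)) / 16"
    using abs_le[of "sin x"] sq unfolding cos4 by (simp add: power2_diff power2_sum field_simps)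
qed

section \<open>Exponential sums\<close>

lemma cis_sum: "cis (\<Sum>i\<in>A. f i) = (\<Prod>i\<in>A. cis (f i))"
  by (induction A rule: infinite_finite_induct) (auto simp: cis_mult[symmetric])

lemma norm_cis_minus_1: "norm (cis t - 1) = 2 * \<bar>sin (t / 2)\<bar>"
  using dist_exp_i_1[of t] by (simp add: cis_conv_exp)

lemma cis_mod_nat:
  assumes "0 < Q"
  shows "cis (2 * pi * real a / real Q) = cis (2 * pi * real (a mod Q) / real Q)"
proof -
  have "real a = real (a div Q) * real Q + real (a mod Q)"
    by (metis div_mult_mod_eq of_nat_add of_nat_mult)
  then have "2 * pi * real a / real Q = 2 * pi * real (a div Q) + 2 * pi * real (a mod Q) / real Q"
    using assms by (simp add: field_simps)
  then show ?thesis by (simp flip: cis_mult)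
qed

text \<open>A geometric sum. The bound on \<open>x\<close> makes vanishing modulo \<open>M\<close>
  the same as vanishing, so the sum detects equality of integers.\<close>

lemma sum_cis_roots_of_unity:
  assumes "x \<in> \<int>" "\<bar>x\<bar> < real M"
  shows "(\<Sum>a<M. cis (2 * pi * real a * x / real M)) = (if x = 0 then of_nat M else 0)"
proof (cases "x = 0")
  case False
  let ?w = "cis (2 * pi * x / real M)"
  have M: "0 < real M" using assms by linarith
  have "?w \<noteq> 1"
  proof
    assume "?w = 1"
    then have "cos (2 * pi * x / real M) = 1" by (simp add: complex_eq_iff)
    then obtain n :: int where "2 * pi * x / real M = of_int n * 2 * pi"
      unfolding cos_one_2pi_int by blast
    then have n: "x = of_int n * real M" using M by (simp add: field_simps)
    then have "n \<noteq> 0" using False by auto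
    then have "1 \<le> \<bar>real_of_int n\<bar>" by linarith
    then have "real M \<le> \<bar>x\<bar>" unfolding n abs_mult using M by simp
    then show False using assms by simp
  qed
  moreover have "?w ^ M = 1"
  proof -
    have "real M * (2 * pi * x / real M) = 2 * pi * x" using M by simp
    then show ?thesis unfolding Complex.DeMoivre by (simp only: cis_multiple_2pi[OF assms(1)])
  qed
  moreover have "(\<Sum>a<M. cis (2 * pi * real a * x / real M)) = (\<Sum>a<M. ?w ^ a)"
    by (simp add: Complex.DeMoivre mult_ac)
  ultimately show ?thesis using False by (simp add: sum_gp_strict)
qed simp

definition linear_form :: "'i set \<Rightarrow> ('i \<Rightarrow> nat) \<Rightarrow> ('i \<Rightarrow> real) \<Rightarrow> real" where
  "linear_form A u z = (\<Sum>i\<in>A. real (u i) * z i)"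

text \<open>The exponential sum factors over the coordinates: one in \<open>S\<close> contributes
  \<open>2 * \<i> * sin\<close>, one outside contributes \<open>2 * cos\<close>, and the common
  bound for both removes the dependence on \<open>S\<close>.\<close>

lemma norm_character_sum_le:
  fixes u :: "'i \<Rightarrow> nat"
  assumes A: "finite A" and S: "S \<subseteq> A"
  shows "norm (\<Sum>z\<in>sign_cube A. of_real (character S z) * cis (\<theta> * linear_form A u z))
    \<le> 2 ^ card A * (\<Prod>i\<in>A. (15 + cos (4 * \<theta> * real (u i))) / 16)"
proof -
  define \<phi> where "\<phi> i b = of_real (if i \<in> S then b else 1) * cis (\<theta> * real (u i) * b)" for i b
  have "of_real (character S z) * cis (\<theta> * linear_form A u z) = (\<Prod>i\<in>A. \<phi> i (z i))" for z
  proof -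
    have "character S z = (\<Prod>i\<in>A. if i \<in> S then z i else 1)"
      unfolding character_def using S by (simp add: prod.If_cases[OF A] Int_absorb1)
    then show ?thesis
      unfolding \<phi>_def linear_form_def by (simp add: prod.distrib sum_distrib_left cis_sum mult.assoc)
  qed
  then have "(\<Sum>z\<in>sign_cube A. of_real (character S z) * cis (\<theta> * linear_form A u z))
      = (\<Prod>i\<in>A. \<Sum>b\<in>{-1, 1}. \<phi> i b)"
    unfolding sign_cube_def by (subst prod_sum_PiE) (simp_all add: A)
  then have "norm (\<Sum>z\<in>sign_cube A. of_real (character S z) * cis (\<theta> * linear_form A u z))
      = (\<Prod>i\<in>A. norm (\<Sum>b\<in>{-1, 1}. \<phi> i b))"
    by (simp add: prod_norm del: sum.insert)
  also have "\<dots> \<le> (\<Prod>i\<in>A. 2 * ((15 + cos (4 * \<theta> * real (u i))) / 16))"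
  proof (intro prod_mono conjI)
    fix i
    let ?x = "\<theta> * real (u i)"
    have "(\<Sum>b\<in>{-1, 1}. \<phi> i b) = (if i \<in> S then 2 * \<i> * of_real (sin ?x) else of_real (2 * cos ?x))"
      unfolding \<phi>_def by (auto simp: complex_eq_iff)
    then have "norm (\<Sum>b\<in>{-1, 1}. \<phi> i b) = 2 * (if i \<in> S then \<bar>sin ?x\<bar> else \<bar>cos ?x\<bar>)"
      by (simp add: norm_mult)
    then show "norm (\<Sum>b\<in>{-1, 1}. \<phi> i b) \<le> 2 * ((15 + cos (4 * \<theta> * real (u i))) / 16)"
      using abs_cos_le[of ?x] abs_sin_le[of ?x] by (simp add: mult_ac)
  qed simp
  also have "\<dots> = 2 ^ card A * (\<Prod>i\<in>A. (15 + cos (4 * \<theta> * real (u i))) / 16)"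
    by (subst prod.distrib) simp
  finally show ?thesis .
qed

text \<open>With \<open>R / Q = 2\<^sup>-\<^sup>k\<close>, the distance of \<open>a / Q\<close> to the integers is at least \<open>2\<^sup>-\<^sup>k\<close>.\<close>
definition far_residue :: "nat \<Rightarrow> nat \<Rightarrow> nat \<Rightarrow> bool" where
  "far_residue R Q a \<longleftrightarrow> R \<le> a mod Q \<and> a mod Q + R \<le> Q"

text \<open>At most \<open>2 * R\<close> residues modulo \<open>Q\<close> lie within less than
  \<open>R\<close> of a multiple of \<open>Q\<close>, and each occurs four times below
  \<open>4 * Q\<close>.\<close>

lemma card_near_residues:
  assumes "0 < Q"
  shows "card {a\<in>{..<4 * Q}. \<not> far_residue R Q a} \<le> 8 * R"
proof -
  let ?T = "{..<R} \<union> {Q - R<..<Q}"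
  have "card {a\<in>{..<4 * Q}. \<not> far_residue R Q a} \<le> card ({..<4::nat} \<times> ?T)"
  proof (rule card_inj_on_le[where f = "\<lambda>a. (a div Q, a mod Q)"])
    show "inj_on (\<lambda>a. (a div Q, a mod Q)) {a\<in>{..<4 * Q}. \<not> far_residue R Q a}"
      by (rule inj_onI) (metis div_mult_mod_eq prod.inject)
    show "(\<lambda>a. (a div Q, a mod Q)) ` {a\<in>{..<4 * Q}. \<not> far_residue R Q a} \<subseteq> {..<4} \<times> ?T"
      using assms by (auto simp: far_residue_def less_mult_imp_div_less)
  qed auto
  also have "\<dots> \<le> 4 * (R + R)"
    unfolding card_cartesian_product
    by (intro mult_mono order.trans[OF card_Un_le] add_mono) auto
  finally show ?thesis by simp
qed

text \<open>A chord is at most its arc, here \<open>2 * pi * R / Q\<close> at most, and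
  \<open>pi < 4\<close>. Residues close to \<open>Q\<close> are first shifted by
  \<open>-Q\<close>.\<close>

lemma near_residue_chord:
  assumes "0 < Q" "\<not> far_residue R Q a"
  shows "norm (cis (2 * pi * real a / real Q) - 1) \<le> 8 * real R / real Q"
proof -
  let ?r = "a mod Q"
  have r: "?r < Q" using assms by simp
  have chord: "norm (cis (2 * pi * y / real Q) - 1) \<le> 8 * real R / real Q" if "\<bar>y\<bar> \<le> real R" for y
  proof -
    have "norm (cis (2 * pi * y / real Q) - 1) \<le> 2 * \<bar>pi * y / real Q\<bar>"
      unfolding norm_cis_minus_1 using abs_sin_x_le_abs_x[of "pi * y / real Q"] by simp
    also have "\<dots> = 2 * pi * \<bar>y\<bar> / real Q" by (simp add: abs_mult)
    also have "\<dots> \<le> 8 * real R / real Q"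
      using that pi_less_4 by (intro divide_right_mono mult_mono) auto
    finally show ?thesis .
  qed
  show ?thesis
  proof (cases "?r < R")
    case True
    then show ?thesis unfolding cis_mod_nat[OF assms(1), of a] by (intro chord) simp
  next
    case False
    then have "Q < ?r + R" using assms(2) by (auto simp: far_residue_def)
    then have "\<bar>real ?r - real Q\<bar> \<le> real R" using r by linarith
    moreover have "cis (2 * pi * real ?r / real Q) = cis (2 * pi * (real ?r - real Q) / real Q)"
    proof -
      have "2 * pi * real ?r / real Q = 2 * pi * (real ?r - real Q) / real Q + 2 * pi"
        using assms(1) by (simp add: field_simps)
      then show ?thesis by (simp flip: cis_mult)
    qed
    ultimately show ?thesis unfolding cis_mod_nat[OF assms(1), of a] using chord by simp
  qed
qed

lemma linear_form_Ints: "z \<in> sign_cube A \<Longrightarrow> linear_form A u z \<in> \<int>"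
  unfolding linear_form_def by (intro Ints_sum Ints_mult) (auto dest!: sign_cubeD)

lemma linear_form_bound:
  assumes "z \<in> sign_cube A" "sum u A \<le> R"
  shows "\<bar>linear_form A u z\<bar> \<le> real R"
proof -
  have "\<bar>\<Sum>i\<in>A. real (u i) * z i\<bar> \<le> (\<Sum>i\<in>A. real (u i))"
    by (rule order.trans[OF sum_abs sum_mono])
      (use sign_cubeD[OF assms(1)] in \<open>force simp: abs_mult\<close>)
  then show ?thesis unfolding linear_form_def using assms(2) by (metis of_nat_le_iff of_nat_sum order_trans)
qed

text \<open>In the Fourier expansion modulo \<open>M\<close>, the shift by 4 turns the coefficient
  of frequency \<open>a\<close> into a multiple of \<open>1 - cis (2 * pi * a / Q)\<close>. For near
  residues it is at most \<open>8 * R / Q\<close>, and only \<open>8 * R\<close> frequencies are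
  near. For far ones it is at most 2, and \<open>far\<close> bounds the sum of the products.\<close>

lemma level_difference_fourier_le:
  fixes u :: "'i \<Rightarrow> nat" and A :: "'i set"
  defines "V \<equiv> linear_form A u"
  assumes A: "finite A" and S: "S \<subseteq> A" and z1: "z1 \<in> sign_cube A"
    and k: "1 \<le> k" and R: "1 \<le> R" "sum u A \<le> R" and Q: "Q = 2 ^ k * R"
    and far: "(\<Sum>a | a < 4 * Q \<and> far_residue R Q a.
        \<Prod>i\<in>A. (15 + cos (2 * pi * real a * real (u i) / real Q)) / 16) \<le> 4 * real Q * \<delta>"
  shows "\<bar>\<Sum>z\<in>sign_cube A. (of_bool (V z = V z1) - of_bool (V z = V z1 - 4)) * character S z\<bar>
    \<le> 2 ^ card A * (16 / 4 ^ k + 2 * \<delta>)"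
proof -
  \<comment> \<open>A modulus divisible by \<open>4\<close> turns the phase \<open>4a / M\<close> of the shift into \<open>a / Q\<close>.\<close>
  define M where "M = 4 * Q"
  define t where "t = V z1"
  define p where "p a = (\<Prod>i\<in>A. (15 + cos (2 * pi * real a * real (u i) / real Q)) / 16)" for a :: nat
  define c where "c a = cis (- (2 * pi * real a * t / real M)) * (1 - cis (2 * pi * real a / real Q))" for a :: nat
  define T where "T a = (\<Sum>z\<in>sign_cube A. of_real (character S z) * cis (2 * pi * real a / real M * V z))" for a :: nat
  define D where "D = (\<Sum>z\<in>sign_cube A. (of_bool (V z = t) - of_bool (V z = t - 4)) * character S z)"
  have "(2::nat) ^ 1 \<le> 2 ^ k" using k by (intro power_increasing) auto
  then have Q2: "2 * R \<le> Q" unfolding Q by simp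
  have Q0: "0 < Q" and M0: "0 < real M" using Q2 R by (auto simp: M_def)
  \<comment> \<open>No wraparound: \<open>V z - t\<close> and \<open>V z - t + 4\<close> are at most
    \<open>2 * R + 4\<close> in absolute value, so equality modulo \<open>M\<close> is
    equality.\<close>
  have M_big: "2 * real R + 4 < real M" using Q2 R unfolding M_def by linarith
  have T: "norm (T a) \<le> 2 ^ card A * p a" for a
  proof -
    have "4 * (2 * pi * real a / real M) * real (u i) = 2 * pi * real a * real (u i) / real Q" for i
      unfolding M_def by simp
    then show ?thesis
      using norm_character_sum_le[OF A S, of "2 * pi * real a / real M" u]
      unfolding T_def V_def p_def by simp
  qed
  have p: "0 \<le> p a" "p a \<le> 1" for a
  proof -
    have "0 \<le> 15 + cos y" "15 + cos y \<le> 16" for y :: real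
      using cos_ge_minus_one[of y] cos_le_one[of y] by linarith+
    then show "0 \<le> p a" "p a \<le> 1" unfolding p_def by (auto intro!: prod_nonneg prod_le_1)
  qed
  have ind: "of_real (real M * (of_bool (V z = t) - of_bool (V z = t - 4)))
      = (\<Sum>a<M. c a * cis (2 * pi * real a / real M * V z))" if z: "z \<in> sign_cube A" for z
  proof -
    have int: "V z - t \<in> \<int>" "V z - t + 4 \<in> \<int>"
      unfolding V_def t_def using linear_form_Ints[OF z, of u] linear_form_Ints[OF z1, of u]
      by (auto intro!: Ints_diff Ints_add)
    have "\<bar>V z\<bar> \<le> R" "\<bar>t\<bar> \<le> R"
      unfolding V_def t_def using linear_form_bound[OF z R(2)] linear_form_bound[OF z1 R(2)] by auto
    then have bd: "\<bar>V z - t\<bar> < real M" "\<bar>V z - t + 4\<bar> < real M"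
      using M_big by linarith+
    have "of_real (real M * (of_bool (V z = t) - of_bool (V z = t - 4)))
        = (\<Sum>a<M. cis (2 * pi * real a * (V z - t) / real M))
          - (\<Sum>a<M. cis (2 * pi * real a * (V z - t + 4) / real M))"
      using sum_cis_roots_of_unity[OF int(1) bd(1)] sum_cis_roots_of_unity[OF int(2) bd(2)]
      by (auto simp: algebra_simps)
    also have "\<dots> = (\<Sum>a<M. c a * cis (2 * pi * real a / real M * V z))"
      unfolding sum_subtractf[symmetric]
    proof (rule sum.cong[OF refl])
      fix a
      have "c a * cis (2 * pi * real a / real M * V z)
          = cis (- (2 * pi * real a * t / real M)) * cis (2 * pi * real a / real M * V z)
            - cis (- (2 * pi * real a * t / real M)) * cis (2 * pi * real a / real Q)
              * cis (2 * pi * real a / real M * V z)"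
        unfolding c_def by (simp add: algebra_simps)
      also have "\<dots> = cis (2 * pi * real a * (V z - t) / real M)
            - cis (2 * pi * real a * (V z - t + 4) / real M)"
      proof -
        have "- (2 * pi * real a * t / real M) + 2 * pi * real a / real M * V z
            = 2 * pi * real a * (V z - t) / real M"
          using M0 by (simp add: field_simps)
        moreover have "- (2 * pi * real a * t / real M) + 2 * pi * real a / real Q
            + 2 * pi * real a / real M * V z = 2 * pi * real a * (V z - t + 4) / real M"
          using Q0 by (simp add: M_def field_simps)
        ultimately show ?thesis by (simp only: cis_mult)
      qed
      finally show "cis (2 * pi * real a * (V z - t) / real M)
          - cis (2 * pi * real a * (V z - t + 4) / real M) = c a * cis (2 * pi * real a / real M * V z)"
        by simp
    qed
    finally show ?thesis .
  qed
  have "complex_of_real (real M * D) = (\<Sum>z\<in>sign_cube A. of_real (character S z) *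
      of_real (real M * (of_bool (V z = t) - of_bool (V z = t - 4))))"
    unfolding D_def by (simp add: sum_distrib_left mult_ac)
  also have "\<dots> = (\<Sum>z\<in>sign_cube A. \<Sum>a<M. c a * (of_real (character S z) * cis (2 * pi * real a / real M * V z)))"
    by (intro sum.cong refl) (simp only: ind sum_distrib_left mult_ac)
  also have "\<dots> = (\<Sum>a<M. c a * T a)"
    unfolding T_def sum_distrib_left by (rule sum.swap)
  finally have "real M * \<bar>D\<bar> = norm (\<Sum>a<M. c a * T a)"
    by (metis abs_mult abs_of_nat norm_of_real)
  also have "\<dots> \<le> (\<Sum>a<M. norm (c a) * norm (T a))"
    unfolding norm_mult[symmetric] by (rule norm_sum)
  also have "\<dots> \<le> (\<Sum>a<M. norm (c a) * (2 ^ card A * p a))"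
    by (intro sum_mono mult_left_mono T) simp
  also have "\<dots> = 2 ^ card A * (\<Sum>a<M. norm (c a) * p a)"
    by (simp add: sum_distrib_left mult_ac)
  also have "(\<Sum>a<M. norm (c a) * p a) = (\<Sum>a\<in>{a\<in>{..<M}. far_residue R Q a}. norm (c a) * p a)
      + (\<Sum>a\<in>{a\<in>{..<M}. \<not> far_residue R Q a}. norm (c a) * p a)"
    by (subst sum.union_disjoint[symmetric]) (auto intro: sum.cong)
  also have "\<dots> \<le> (\<Sum>a\<in>{a\<in>{..<M}. far_residue R Q a}. 2 * p a)
      + (\<Sum>a\<in>{a\<in>{..<M}. \<not> far_residue R Q a}. 8 * real R / real Q)"
  proof (intro add_mono sum_mono)
    fix a
    have nc: "norm (c a) = norm (cis (2 * pi * real a / real Q) - 1)"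
      unfolding c_def by (simp add: norm_mult norm_minus_commute)
    also have "\<dots> \<le> 2" unfolding norm_cis_minus_1 by simp
    finally show "norm (c a) * p a \<le> 2 * p a" using p by (intro mult_right_mono)
    show "norm (c a) * p a \<le> 8 * real R / real Q" if "a \<in> {a\<in>{..<M}. \<not> far_residue R Q a}"
    proof -
      have "norm (c a) * p a \<le> norm (c a) * 1" using p by (intro mult_left_mono) auto
      also have "\<dots> \<le> 8 * real R / real Q"
        unfolding nc using near_residue_chord[OF Q0] that by simp
      finally show ?thesis .
    qed
  qed
  also have "\<dots> \<le> 2 * (real M * \<delta>) + real (8 * R) * (8 * real R / real Q)"
  proof (rule add_mono)
    show "(\<Sum>a\<in>{a\<in>{..<M}. far_residue R Q a}. 2 * p a) \<le> 2 * (real M * \<delta>)"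
      unfolding sum_distrib_left[symmetric] using far unfolding p_def M_def by (simp add: mult_ac)
    have "real (card {a\<in>{..<M}. \<not> far_residue R Q a}) \<le> real (8 * R)"
      unfolding M_def of_nat_le_iff by (rule card_near_residues[OF Q0])
    then show "(\<Sum>a\<in>{a\<in>{..<M}. \<not> far_residue R Q a}. 8 * real R / real Q)
        \<le> real (8 * R) * (8 * real R / real Q)"
      unfolding sum_constant by (intro mult_right_mono) auto
  qed
  \<comment> \<open>The near part is \<open>64 * R^2 / Q\<close>, which is
    \<open>M * 16 * (R / Q)^2\<close>.\<close>
  also have "\<dots> = real M * (16 / 4 ^ k + 2 * \<delta>)"
  proof -
    have "(4::real) ^ k = 2 ^ k * 2 ^ k" by (simp flip: power_mult_distrib)
    then show ?thesis using R unfolding M_def Q by (simp add: field_simps power2_eq_square)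
  qed
  finally have "real M * \<bar>D\<bar> \<le> real M * (2 ^ card A * (16 / 4 ^ k + 2 * \<delta>))"
    by (simp add: mult_ac)
  then show ?thesis using M0 unfolding D_def t_def by simp
qed

text \<open>Pigeonhole over the \<open>2 * R + 1\<close> integers in the range of the form. The
  level is given by a point \<open>z1\<close> attaining it, whose coordinates can later serve as
  constants that cancel the level.\<close>

lemma exists_popular_level:
  assumes A: "finite A" and R: "sum u A \<le> R"
  shows "\<exists>z1\<in>sign_cube A. 2 ^ card A \<le>
    (2 * R + 1) * card {z\<in>sign_cube A. linear_form A u z = linear_form A u z1}"
proof -
  let ?V = "linear_form A u" and ?B = "real_of_int ` {- int R..int R}"
  have "?V \<in> sign_cube A \<rightarrow> ?B"
  proof
    fix z assume z: "z \<in> sign_cube A"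
    obtain n where n: "?V z = of_int n" using linear_form_Ints[OF z, of u] by (auto elim: Ints_cases)
    then show "?V z \<in> ?B" using linear_form_bound[OF z R] by (auto intro!: imageI)
  qed
  then obtain y where y: "card (sign_cube A) \<le> card (?V -` {y} \<inter> sign_cube A) * card ?B"
    using pigeonhole_card[of ?V "sign_cube A" ?B] finite_sign_cube[OF A] by auto
  have card_B: "card ?B = 2 * R + 1"
    by (subst card_image) (auto simp: inj_on_def)
  have "card (?V -` {y} \<inter> sign_cube A) \<noteq> 0"
    using y unfolding card_sign_cube[OF A] by (metis mult_0 not_less zero_less_power pos2)
  then have "?V -` {y} \<inter> sign_cube A \<noteq> {}" by (metis card.empty)
  then obtain z1 where z1: "z1 \<in> sign_cube A" "?V z1 = y" by blast
  have "?V -` {y} \<inter> sign_cube A = {z\<in>sign_cube A. ?V z = ?V z1}" using z1 by auto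
  with y z1 show ?thesis unfolding card_B card_sign_cube[OF A] by (auto simp: mult.commute)
qed

section \<open>Lower bounds from a hard subcube\<close>

lemma sum_subcube:
  assumes "A \<subseteq> I" "c \<in> sign_cube I" "finite I"
  shows "(\<Sum>z\<in>sign_cube I. if \<forall>i\<in>I - A. z i = c i then F z else 0)
    = (\<Sum>\<zeta>\<in>sign_cube A. F (\<lambda>i\<in>I. if i \<in> A then \<zeta> i else c i))"
proof -
  have "(\<Sum>z\<in>sign_cube I. if \<forall>i\<in>I - A. z i = c i then F z else 0)
      = (\<Sum>z\<in>{z\<in>sign_cube I. \<forall>i\<in>I - A. z i = c i}. F z)"
    by (rule sum.inter_filter[symmetric]) (rule finite_sign_cube[OF assms(3)])
  also have "\<dots> = (\<Sum>\<zeta>\<in>sign_cube A. F (\<lambda>i\<in>I. if i \<in> A then \<zeta> i else c i))"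
  proof (rule sum.reindex_bij_witness[where j = "\<lambda>z. restrict z A"
        and i = "\<lambda>\<zeta>. \<lambda>i\<in>I. if i \<in> A then \<zeta> i else c i"])
    fix z assume "z \<in> {z\<in>sign_cube I. \<forall>i\<in>I - A. z i = c i}"
    then have z: "z \<in> I \<rightarrow>\<^sub>E {- 1, 1}" "\<And>i. i \<in> I - A \<Longrightarrow> z i = c i"
      by (auto simp: sign_cube_def)
    show eq: "(\<lambda>i\<in>I. if i \<in> A then restrict z A i else c i) = z"
    proof
      fix i show "(\<lambda>i\<in>I. if i \<in> A then restrict z A i else c i) i = z i"
        using z(2)[of i] PiE_arb[OF z(1), of i] by (cases "i \<in> I") auto
    qed
    show "restrict z A \<in> sign_cube A"
      unfolding sign_cube_def by (rule restrict_PiE_iff[THEN iffD2]) (use z(1) assms(1) PiE_mem in blast)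
    show "F (\<lambda>i\<in>I. if i \<in> A then restrict z A i else c i) = F z" by (simp only: eq)
  next
    fix \<zeta> assume "\<zeta> \<in> sign_cube A"
    then have \<zeta>: "\<zeta> \<in> A \<rightarrow>\<^sub>E {- 1, 1}" by (simp add: sign_cube_def)
    show "restrict (\<lambda>i\<in>I. if i \<in> A then \<zeta> i else c i) A = \<zeta>"
    proof
      fix i show "restrict (\<lambda>i\<in>I. if i \<in> A then \<zeta> i else c i) A i = \<zeta> i"
        using PiE_arb[OF \<zeta>, of i] assms(1) by (cases "i \<in> A") auto
    qed
    have "(\<lambda>i\<in>I. if i \<in> A then \<zeta> i else c i) \<in> I \<rightarrow>\<^sub>E {- 1, 1}"
    proof (rule restrict_PiE_iff[THEN iffD2], rule ballI)
      fix i assume "i \<in> I"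
      then show "(if i \<in> A then \<zeta> i else c i) \<in> {- 1, 1}"
        using PiE_mem[OF \<zeta>, of i] sign_cubeD[OF assms(2), of i] by auto
    qed
    then show "(\<lambda>i\<in>I. if i \<in> A then \<zeta> i else c i) \<in> {z\<in>sign_cube I. \<forall>i\<in>I - A. z i = c i}"
      by (simp add: sign_cube_def)
  qed
  finally show ?thesis .
qed

text \<open>The discrepancy is at most \<open>2 ^ 12 * k / 2 ^ k\<close>, whose inverse has
  logarithm \<open>k - 12 - log 2 k\<close>; the last term costs at most
  \<open>k / 2 + 1\<close>.\<close>

lemma log_inverse_discrepancy_ge:
  assumes k: "1 \<le> k" and R: "R = 64 * k * 2 ^ k"
  shows "real k / 2 - 13 \<le> log 2 (1 / (18 * (2 * real R + 1) / 4 ^ k))"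
proof -
  define j where "j = k div 2"
  have "k \<le> 2 * j + 1" by (simp add: j_def)
  also have "\<dots> \<le> 2 * 2 ^ j" using less_exp[of j] by linarith
  finally have "real k \<le> 2 ^ Suc j" by (metis of_nat_le_iff of_nat_numeral of_nat_power power_Suc)
  then have "log 2 (real k) \<le> log 2 (2 ^ Suc j)"
    using k by (subst log_le_cancel_iff) auto
  also have "\<dots> = real j + 1" by (subst log_nat_power) auto
  also have "\<dots> \<le> real k / 2 + 1" unfolding j_def by linarith
  finally have logk: "log 2 (real k) \<le> real k / 2 + 1" .
  have "1 \<le> real k * 2 ^ k" using k mult_mono[of 1 "real k" 1 "2 ^ k"] by simp
  then have "18 * (2 * real R + 1) \<le> 2 ^ 12 * real k * 2 ^ k" unfolding R by simp
  then have "18 * (2 * real R + 1) * 2 ^ k \<le> 2 ^ 12 * real k * 2 ^ k * 2 ^ k"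
    by (rule mult_right_mono) simp
  moreover have "(4::real) ^ k = 2 ^ k * 2 ^ k" by (simp flip: power_mult_distrib)
  ultimately have "2 ^ k / (2 ^ 12 * real k) \<le> 1 / (18 * (2 * real R + 1) / 4 ^ k)"
    using k by (simp add: field_simps)
  then have "log 2 (2 ^ k / (2 ^ 12 * real k)) \<le> log 2 (1 / (18 * (2 * real R + 1) / 4 ^ k))"
    using k by (subst log_le_cancel_iff) auto
  moreover have "log 2 (2 ^ k / (2 ^ 12 * real k)) = real k - (12 + log 2 (real k))"
  proof -
    have "log 2 (2 ^ k / (2 ^ 12 * real k)) = log 2 (2 ^ k) - (log 2 (2 ^ 12) + log 2 (real k))"
      using k by (subst log_divide; (subst log_mult)?) auto
    moreover have "log 2 (2 ^ k) = real k" "log 2 (2 ^ 12 :: real) = 12"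
      using log_nat_power[of 2 2 k] log_nat_power[of 2 2 12] by auto
    ultimately show ?thesis by simp
  qed
  ultimately show ?thesis using logk by linarith
qed

text \<open>The witness \<open>h\<close> lives on the subcube where the coordinates outside
  \<open>A\<close> are fixed to \<open>c\<close>: it is 1 on the popular level, -1 on the level 4
  below and 0 elsewhere. Its mass is at least \<open>2 ^ card A / (2 * R + 1)\<close>, its
  correlations are at most \<open>2 ^ card A * 18 / 4 ^ k\<close>, and \<open>f\<close> only has to
  have the right sign on these two levels.\<close>

lemma PP_xor_ge_of_subcube:
  fixes u :: "'i \<Rightarrow> nat" and f :: "('i \<Rightarrow> real) \<Rightarrow> real"
  assumes I: "finite I" and AI: "A \<subseteq> I" and c: "c \<in> sign_cube I" and z1: "z1 \<in> sign_cube A"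
    and k: "1 \<le> k" and R: "R = 64 * k * 2 ^ k" "sum u A \<le> R" and Q: "Q = 2 ^ k * R"
    and far: "(\<Sum>a | a < 4 * Q \<and> far_residue R Q a.
        \<Prod>i\<in>A. (15 + cos (2 * pi * real a * real (u i) / real Q)) / 16) \<le> 4 * real Q * (1 / 4 ^ k)"
    and popular: "2 ^ card A \<le> (2 * R + 1) * card {z\<in>sign_cube A. linear_form A u z = linear_form A u z1}"
    and f_pos: "\<And>z. z \<in> sign_cube I \<Longrightarrow> \<forall>i\<in>I - A. z i = c i \<Longrightarrow>
      linear_form A u z = linear_form A u z1 \<Longrightarrow> f z = 1"
    and f_neg: "\<And>z. z \<in> sign_cube I \<Longrightarrow> \<forall>i\<in>I - A. z i = c i \<Longrightarrow>
      linear_form A u z = linear_form A u z1 - 4 \<Longrightarrow> f z = - 1"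
  shows "real k / 2 - 13 \<le> PP_xor I f"
proof -
  let ?V = "linear_form A u" and ?e = "\<lambda>\<zeta>. \<lambda>i\<in>I. if i \<in> A then \<zeta> i else c i"
  have A: "finite A" using I AI finite_subset by blast
  define q where "q v = of_bool (v = ?V z1) - (of_bool (v = ?V z1 - 4) :: real)" for v
  define h where "h z = (if \<forall>i\<in>I - A. z i = c i then q (?V z) else 0)" for z
  define \<delta> where "\<delta> = 18 * (2 * real R + 1) / 4 ^ k"
  have V_e: "?V (?e \<zeta>) = ?V \<zeta>" for \<zeta>
    unfolding linear_form_def by (rule sum.cong) (use AI in auto)
  have R1: "1 \<le> R" using k unfolding R by simp
  have "(\<Sum>z\<in>sign_cube I. \<bar>h z\<bar>) = (\<Sum>z\<in>sign_cube I. if \<forall>i\<in>I - A. z i = c i then \<bar>q (?V z)\<bar> else 0)"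
    by (rule sum.cong) (auto simp: h_def)
  then have norm_h: "(\<Sum>z\<in>sign_cube I. \<bar>h z\<bar>) = (\<Sum>\<zeta>\<in>sign_cube A. \<bar>q (?V \<zeta>)\<bar>)"
    by (simp only: sum_subcube[OF AI c I] V_e)
  have "2 ^ card A \<le> (2 * real R + 1) * real (card {z\<in>sign_cube A. ?V z = ?V z1})"
  proof -
    have "real (2 ^ card A) \<le> real ((2 * R + 1) * card {z\<in>sign_cube A. ?V z = ?V z1})"
      unfolding of_nat_le_iff by (rule popular)
    then show ?thesis by (simp add: algebra_simps)
  qed
  also have "real (card {z\<in>sign_cube A. ?V z = ?V z1}) = (\<Sum>\<zeta>\<in>sign_cube A. of_bool (?V \<zeta> = ?V z1))"
    using finite_sign_cube[OF A] by (simp add: Int_def)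
  also have "\<dots> \<le> (\<Sum>\<zeta>\<in>sign_cube A. \<bar>q (?V \<zeta>)\<bar>)"
    by (rule sum_mono) (auto simp: q_def)
  finally have mass: "2 ^ card A \<le> (2 * real R + 1) * (\<Sum>z\<in>sign_cube I. \<bar>h z\<bar>)"
    unfolding norm_h by (simp add: mult_left_mono)
  have "log 2 (1 / \<delta>) \<le> PP_xor I f"
  proof (rule PP_xor_ge_log_fourier[OF I, where h = h])
    show "h z * f z = \<bar>h z\<bar>" if "z \<in> sign_cube I" for z
      using f_pos[OF that] f_neg[OF that] by (auto simp: h_def q_def)
    show "0 < \<delta>" by (auto simp: \<delta>_def intro!: divide_pos_pos add_nonneg_pos)
    have "0 < (2 * real R + 1) * (\<Sum>z\<in>sign_cube I. \<bar>h z\<bar>)"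
      using mass by (rule less_le_trans[rotated]) simp
    then show "0 < (\<Sum>z\<in>sign_cube I. \<bar>h z\<bar>)" by (simp add: zero_less_mult_iff)
    fix S assume S: "S \<subseteq> I"
    have SA: "finite S" using S I finite_subset by blast
    have char_e: "character S (?e \<zeta>) = character (S \<inter> A) \<zeta> * character (S - A) c" for \<zeta>
    proof -
      have "character S (?e \<zeta>) = (\<Prod>i\<in>S. if i \<in> A then \<zeta> i else c i)"
        unfolding character_def by (rule prod.cong) (use S in auto)
      then show ?thesis using SA by (simp add: character_def prod.If_cases Diff_eq)
    qed
    \<comment> \<open>The fixed coordinates multiply a character only by a sign.\<close>
    have "\<bar>c i\<bar> = 1" if "i \<in> I" for i using sign_cubeD[OF c that] by auto
    then have abs_c: "\<bar>character (S - A) c\<bar> = 1"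
      unfolding character_def abs_prod using S by (intro prod.neutral) auto
    have "(\<Sum>z\<in>sign_cube I. h z * character S z)
        = (\<Sum>z\<in>sign_cube I. if \<forall>i\<in>I - A. z i = c i then q (?V z) * character S z else 0)"
      by (rule sum.cong) (auto simp: h_def)
    also have "\<dots> = (\<Sum>\<zeta>\<in>sign_cube A. q (?V \<zeta>) * character (S \<inter> A) \<zeta>) * character (S - A) c"
      by (simp only: sum_subcube[OF AI c I] V_e char_e sum_distrib_right mult.assoc)
    finally have "\<bar>\<Sum>z\<in>sign_cube I. h z * character S z\<bar>
        = \<bar>\<Sum>\<zeta>\<in>sign_cube A. q (?V \<zeta>) * character (S \<inter> A) \<zeta>\<bar>"
      using abs_c by (simp add: abs_mult)
    also have "\<dots> \<le> 2 ^ card A * (16 / 4 ^ k + 2 * (1 / 4 ^ k))"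
      unfolding q_def by (rule level_difference_fourier_le[OF A _ z1 k R1 R(2) Q far]) simp
    also have "\<dots> \<le> ((2 * real R + 1) * (\<Sum>z\<in>sign_cube I. \<bar>h z\<bar>)) * (16 / 4 ^ k + 2 * (1 / 4 ^ k))"
      by (rule mult_right_mono[OF mass]) simp
    also have "\<dots> = \<delta> * (\<Sum>z\<in>sign_cube I. \<bar>h z\<bar>)"
      unfolding \<delta>_def by (simp add: field_simps)
    finally show "\<bar>\<Sum>z\<in>sign_cube I. h z * character S z\<bar> \<le> \<delta> * (\<Sum>z\<in>sign_cube I. \<bar>h z\<bar>)" .
  qed
  with log_inverse_discrepancy_ge[OF k R(1)] show ?thesis unfolding \<delta>_def by linarith
qed

text \<open>At \<open>k = 28\<close> the affine bound reaches 1; below that the trivial bound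
  suffices.\<close>

lemma linear_bound_of_affine_bound: "1 \<le> (p::real) \<Longrightarrow> real k / 2 - 13 \<le> p \<Longrightarrow> real k / 28 \<le> p"
  by (cases "real k \<le> 28") (auto simp: field_simps)

subsection \<open>Random weights\<close>

text \<open>Jordan's inequality at dyadic points: halving an angle at most halves its sine, starting
  from \<open>sin (pi / 2) = 1\<close>.\<close>

lemma sin_pi_power_ge: "1 \<le> k \<Longrightarrow> 2 / 2 ^ k \<le> sin (pi / 2 ^ k)"
proof (induction k rule: dec_induct)
  case (step k)
  let ?x = "pi / 2 ^ Suc k"
  have "1 < (2::real) ^ Suc k" by (rule one_less_power) auto
  then have "0 \<le> sin ?x" by (intro sin_ge_zero) (auto simp: field_simps)
  have "2 / 2 ^ k \<le> sin (2 * ?x)" using step.IH by simp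
  also have "\<dots> = 2 * (sin ?x * cos ?x)" by (simp only: sin_double mult.assoc)
  also have "\<dots> \<le> 2 * (sin ?x * 1)"
    using \<open>0 \<le> sin ?x\<close> by (intro mult_left_mono) auto
  finally show ?case by simp
qed simp

text \<open>The cosines are real parts of a geometric sum, whose norm is at most 2 divided by the
  chord from 1 to \<open>?w\<close>. As \<open>a / Q\<close> is at least \<open>1 / 2 ^ k\<close>
  away from the integers, that chord is at least \<open>4 / 2 ^ k\<close>.\<close>

lemma sum_cos_far_residue_le:
  assumes k: "1 \<le> k" and R: "1 \<le> R" and Q: "Q = 2 ^ k * R" and far: "far_residue R Q a"
  shows "(\<Sum>w<2 ^ k. cos (2 * pi * real a * real w / real Q)) \<le> 2 ^ k / 2"
proof -
  let ?r = "a mod Q" and ?w = "cis (2 * pi * real a / real Q)"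
  have Q0: "0 < Q" using R unfolding Q by simp
  have RQ: "real R / real Q = 1 / 2 ^ k" using R unfolding Q by simp
  have r: "real R \<le> real ?r" "real ?r + real R \<le> real Q"
    using far unfolding far_residue_def by (metis of_nat_add of_nat_le_iff)+
  have "1 / 2 ^ k \<le> real ?r / real Q" "real ?r / real Q \<le> 1 - 1 / 2 ^ k"
    unfolding RQ[symmetric] using r Q0 by (simp_all add: field_simps)
  then obtain d where d: "1 / 2 ^ k \<le> d" "d \<le> 1 - 1 / 2 ^ k" "d = real ?r / real Q" by blast
  \<comment> \<open>Monotonicity covers \<open>d\<close> up to \<open>1 / 2\<close>; the other half
    follows by the reflection \<open>d\<close> to \<open>1 - d\<close>.\<close>
  have mono: "sin (pi / 2 ^ k) \<le> sin (pi * e)" if "1 / 2 ^ k \<le> e" "e \<le> 1 / 2" for e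
  proof (rule sin_monotone_2pi_le)
    have "0 \<le> pi / 2 ^ k" by simp
    then show "- (pi / 2) \<le> pi / 2 ^ k" using pi_ge_zero by linarith
    show "pi / 2 ^ k \<le> pi * e" using mult_left_mono[OF that(1), of pi] by simp
    show "pi * e \<le> pi / 2" using mult_left_mono[OF that(2), of pi] by simp
  qed
  have "sin (pi / 2 ^ k) \<le> sin (pi * d)"
  proof (cases "d \<le> 1 / 2")
    case True
    then show ?thesis using mono d(1) by blast
  next
    case False
    then have "sin (pi / 2 ^ k) \<le> sin (pi * (1 - d))" using d(2) by (intro mono) linarith+
    also have "pi * (1 - d) = pi - pi * d" by (simp add: algebra_simps)
    finally show ?thesis by simp
  qed
  then have "2 / 2 ^ k \<le> sin (pi * d)" using sin_pi_power_ge[OF k] by linarith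
  moreover have "norm (?w - 1) = 2 * \<bar>sin (pi * d)\<bar>"
    unfolding cis_mod_nat[OF Q0, of a] norm_cis_minus_1 d(3) by simp
  ultimately have chord: "4 / 2 ^ k \<le> norm (?w - 1)" by linarith
  have "(\<Sum>w<2 ^ k. cos (2 * pi * real a * real w / real Q)) = Re (\<Sum>w<2 ^ k. ?w ^ w)"
    by (simp add: Complex.DeMoivre mult_ac)
  also have "\<dots> \<le> norm (\<Sum>w<2 ^ k. ?w ^ w)" by (rule complex_Re_le_cmod)
  finally have le: "(\<Sum>w<2 ^ k. cos (2 * pi * real a * real w / real Q)) \<le> norm (\<Sum>w<2 ^ k. ?w ^ w)" .
  have "norm (\<Sum>w<2 ^ k. ?w ^ w) * (4 / 2 ^ k) \<le> norm (\<Sum>w<2 ^ k. ?w ^ w) * norm (?w - 1)"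
    by (rule mult_left_mono[OF chord]) simp
  also have "\<dots> = norm (?w ^ (2 ^ k) - 1)"
    unfolding norm_mult[symmetric] power_diff_1_eq by (simp only: mult.commute)
  also have "\<dots> \<le> 2"
    using norm_triangle_ineq4[of "?w ^ (2 ^ k)" 1] by (simp add: norm_power)
  finally have "norm (\<Sum>w<2 ^ k. ?w ^ w) \<le> 2 ^ k / 2" by (simp add: field_simps)
  with le show ?thesis by linarith
qed

text \<open>Averaging over independent uniform weights below \<open>2 ^ k\<close>: for a far
  \<open>a\<close> each factor has mean at most \<open>31 / 32\<close>, and
  \<open>(31 / 32) ^ 64 \<le> 1 / 4\<close>, so \<open>64 * k\<close> coordinates give
  \<open>1 / 4 ^ k\<close>.\<close>

lemma exists_weights_small_far_sum:
  assumes k: "1 \<le> k" and R: "1 \<le> R" and Q: "Q = 2 ^ k * R"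
    and A: "finite A" "card A = 64 * k"
  shows "\<exists>u. (\<forall>i\<in>A. u i < 2 ^ k) \<and>
    (\<Sum>a | a < 4 * Q \<and> far_residue R Q a.
        \<Prod>i\<in>A. (15 + cos (2 * pi * real a * real (u i) / real Q)) / 16) \<le> 4 * real Q * (1 / 4 ^ k)"
proof (rule ccontr)
  let ?U = "A \<rightarrow>\<^sub>E {..<(2::nat) ^ k}" and ?F = "{a. a < 4 * Q \<and> far_residue R Q a}"
  let ?g = "\<lambda>a w. (15 + cos (2 * pi * real a * real w / real Q)) / 16"
  assume "\<not> ?thesis"
  then have large: "4 * real Q * (1 / 4 ^ k) < (\<Sum>a\<in>?F. \<Prod>i\<in>A. ?g a (u i))" if "u \<in> ?U" for u
    using that by (fastforce dest: PiE_mem)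
  have Q0: "0 < Q" using R unfolding Q by simp
  have finU: "finite ?U" using A by (intro finite_PiE) auto
  have cardU: "real (card ?U) = (2 ^ k) ^ (64 * k)" using A by (simp add: card_PiE)
  have "?U \<noteq> {}" by (simp add: PiE_eq_empty_iff lessThan_empty_iff)
  then have "(\<Sum>u\<in>?U. 4 * real Q * (1 / 4 ^ k)) < (\<Sum>u\<in>?U. \<Sum>a\<in>?F. \<Prod>i\<in>A. ?g a (u i))"
    by (rule sum_strict_mono[OF finU _ large])
  also have "\<dots> = (\<Sum>a\<in>?F. \<Sum>u\<in>?U. \<Prod>i\<in>A. ?g a (u i))"
    by (rule sum.swap)
  also have "\<dots> = (\<Sum>a\<in>?F. \<Prod>i\<in>A. \<Sum>w<2 ^ k. ?g a w)"
    by (intro sum.cong refl prod_sum_PiE[symmetric]) (use A in auto)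
  also have "\<dots> \<le> (\<Sum>a\<in>?F. (2 ^ k * (31 / 32)) ^ (64 * k))"
  proof (rule sum_mono)
    fix a assume "a \<in> ?F"
    then have "(\<Sum>w<2 ^ k. cos (2 * pi * real a * real w / real Q)) \<le> 2 ^ k / 2"
      by (intro sum_cos_far_residue_le[OF k R Q]) simp
    moreover have "(\<Sum>w<2 ^ k. ?g a w)
        = (15 * 2 ^ k + (\<Sum>w<2 ^ k. cos (2 * pi * real a * real w / real Q))) / 16"
      by (simp add: sum_divide_distrib[symmetric] sum.distrib)
    ultimately have "(\<Sum>w<2 ^ k. ?g a w) \<le> (15 * 2 ^ k + 2 ^ k / 2) / 16"
      by (simp only: divide_right_mono add_left_mono)
    then have "(\<Sum>w<2 ^ k. ?g a w) \<le> 2 ^ k * (31 / 32)" by (simp add: field_simps)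
    moreover have "0 \<le> (\<Sum>w<2 ^ k. ?g a w)"
    proof (rule sum_nonneg)
      fix w show "0 \<le> ?g a w"
        by (rule divide_nonneg_pos)
          (use cos_ge_minus_one[of "2 * pi * real a * real w / real Q"] in linarith, simp)
    qed
    ultimately show "(\<Prod>i\<in>A. \<Sum>w<2 ^ k. ?g a w) \<le> (2 ^ k * (31 / 32)) ^ (64 * k)"
      unfolding prod_constant A(2) by (intro power_mono)
  qed
  also have "\<dots> \<le> real (4 * Q) * (2 ^ k * (31 / 32)) ^ (64 * k)"
  proof -
    have "card ?F \<le> card {..<4 * Q}" by (rule card_mono) auto
    then have "real (card ?F) \<le> real (4 * Q)" by simp
    then show ?thesis unfolding sum_constant by (intro mult_right_mono) auto
  qed
  also have "\<dots> = real (4 * Q) * ((2 ^ k) ^ (64 * k) * ((31 / 32) ^ 64) ^ k)"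
    by (simp only: power_mult_distrib power_mult[of "31 / 32 :: real"])
  also have "\<dots> \<le> real (4 * Q) * ((2 ^ k) ^ (64 * k) * (1 / 4) ^ k)"
    by (intro mult_left_mono power_mono) (simp_all add: field_simps)
  also have "\<dots> = (\<Sum>u\<in>?U. 4 * real Q * (1 / 4 ^ k))"
    unfolding sum_constant cardU by (simp add: power_divide)
  finally show False by simp
qed

text \<open>The first \<open>64 * k\<close> coordinates carry the random weights. Coordinate
  \<open>n\<close> carries the threshold, just below the popular level, and the others have weight
  0; hence \<open>n\<close> must exceed \<open>64 * k\<close>.\<close>

lemma exists_hard_halfspace:
  assumes k: "1 \<le> k" and n: "64 * k < n"
  shows "\<exists>f :: (nat \<Rightarrow> real) \<Rightarrow> real.
    linear_threshold {1..n} f \<and> real k / 2 - 13 \<le> PP_xor {1..n} f"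
proof -
  let ?A = "{1..64 * k}" and ?I = "{1..n}"
  define R where "R = 64 * k * 2 ^ k"
  define Q where "Q = 2 ^ k * R"
  have R1: "1 \<le> R" using k by (simp add: R_def)
  obtain u where u: "\<forall>i\<in>?A. u i < 2 ^ k" and far: "(\<Sum>a | a < 4 * Q \<and> far_residue R Q a.
        \<Prod>i\<in>?A. (15 + cos (2 * pi * real a * real (u i) / real Q)) / 16) \<le> 4 * real Q * (1 / 4 ^ k)"
    using exists_weights_small_far_sum[OF k R1 Q_def, of ?A] by auto
  let ?V = "linear_form ?A u"
  have uR: "sum u ?A \<le> R"
  proof -
    have "sum u ?A \<le> of_nat (card ?A) * 2 ^ k"
      by (rule sum_bounded_above) (use u in \<open>auto intro: less_imp_le\<close>)
    then show ?thesis by (simp add: R_def)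
  qed
  obtain z1 where z1: "z1 \<in> sign_cube ?A"
    "2 ^ card ?A \<le> (2 * R + 1) * card {z\<in>sign_cube ?A. ?V z = ?V z1}"
    using exists_popular_level[OF _ uR] by auto
  define w where "w i = (if i \<in> ?A then real (u i) else if i = n then 1 / 2 - ?V z1 else 0)" for i
  define f where "f x = sgn (\<Sum>i\<in>?I. w i * x i)" for x
  have form: "(\<Sum>i\<in>?I. w i * x i) = ?V x + (1 / 2 - ?V z1) * x n" for x
  proof -
    have "?I = ?A \<union> {64 * k<..n}" "{64 * k<..n} = insert n {64 * k<..<n}" using n by auto
    then have "(\<Sum>i\<in>?I. w i * x i)
        = (\<Sum>i\<in>?A \<union> insert n {64 * k<..<n}. w i * x i)" by (simp only:)
    also have "\<dots> = (\<Sum>i\<in>?A. w i * x i) + (\<Sum>i\<in>insert n {64 * k<..<n}. w i * x i)"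
      using n by (intro sum.union_disjoint) auto
    also have "\<dots> = (\<Sum>i\<in>?A. w i * x i) + (w n * x n + (\<Sum>i\<in>{64 * k<..<n}. w i * x i))"
      by simp
    finally have "(\<Sum>i\<in>?I. w i * x i)
        = (\<Sum>i\<in>?A. w i * x i) + (w n * x n + (\<Sum>i\<in>{64 * k<..<n}. w i * x i))" .
    moreover have "(\<Sum>i\<in>?A. w i * x i) = ?V x"
      unfolding linear_form_def by (rule sum.cong) (auto simp: w_def)
    moreover have "(\<Sum>i\<in>{64 * k<..<n}. w i * x i) = 0"
      by (rule sum.neutral) (auto simp: w_def)
    ultimately show ?thesis using n by (simp add: w_def)
  qed
  have "linear_threshold ?I f"
    unfolding linear_threshold_def
  proof (intro exI[of _ w] ballI conjI)
    fix x assume x: "x \<in> sign_cube ?I"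
    show "f x = sgn (\<Sum>i\<in>?I. w i * x i)" by (simp add: f_def)
    have "x \<in> ?A \<rightarrow> {- 1, 1}" using sign_cubeD[OF x] n by auto
    \<comment> \<open>Points of a cube are extensional, so \<open>x\<close> itself need not lie in
      \<open>sign_cube ?A\<close>; \<open>?V\<close> only sees the restriction.\<close>
    then have xA: "restrict x ?A \<in> sign_cube ?A" by (auto simp: sign_cube_def)
    have "?V x = ?V (restrict x ?A)" unfolding linear_form_def by (rule sum.cong) auto
    then obtain p :: int where p: "?V x = of_int p"
      using linear_form_Ints[OF xA, of u] by (auto elim: Ints_cases)
    obtain t :: int where t: "?V z1 = of_int t"
      using linear_form_Ints[OF z1(1), of u] by (auto elim: Ints_cases)
    \<comment> \<open>The summand \<open>1 / 2\<close> in the weight of coordinate \<open>n\<close>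
      makes twice the linear form odd, hence nonzero.\<close>
    have odd: "(2 * p - 2 * t + 1) \<noteq> 0" "(2 * p + 2 * t - 1) \<noteq> 0" by presburger+
    have "x n = - 1 \<or> x n = 1" using sign_cubeD[OF x] n by simp
    then have "2 * (\<Sum>i\<in>?I. w i * x i) = of_int (2 * p - 2 * t + 1)
        \<or> 2 * (\<Sum>i\<in>?I. w i * x i) = of_int (2 * p + 2 * t - 1)"
      unfolding form p t by auto
    then show "(\<Sum>i\<in>?I. w i * x i) \<noteq> 0"
      using odd by (metis mult_zero_right of_int_eq_0_iff)
  qed
  moreover have "real k / 2 - 13 \<le> PP_xor ?I f"
  proof (rule PP_xor_ge_of_subcube[where A = ?A and c = "\<lambda>i\<in>?I. 1", OF _ _ _ z1(1) k R_def uR Q_def far z1(2)])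
    show "(\<lambda>i\<in>?I. 1) \<in> sign_cube ?I" by (auto simp: sign_cube_def)
    fix z :: "nat \<Rightarrow> real" assume "\<forall>i\<in>?I - ?A. z i = (\<lambda>i\<in>?I. 1) i"
    then have "z n = 1" using n by simp
    then show "?V z = ?V z1 \<Longrightarrow> f z = 1" "?V z = ?V z1 - 4 \<Longrightarrow> f z = - 1"
      unfolding f_def form by simp_all
  qed (use n in auto)
  ultimately show ?thesis by blast
qed

lemma linear_PP_lower_bound:
  assumes n: "1 \<le> n"
  shows "\<exists>f :: (nat \<Rightarrow> real) \<Rightarrow> real. linear_threshold {1..n} f \<and> 1 / 3584 * real n \<le> PP_xor {1..n} f"
proof (cases "n \<le> 64")
  case True
  \<comment> \<open>For small \<open>n\<close> any halfspace will do; a dictator is the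
    simplest.\<close>
  let ?f = "\<lambda>x. sgn (\<Sum>i\<in>{1..n}. of_bool (i = 1) * x i) :: real"
  have first: "(\<Sum>i\<in>{1..n}. of_bool (i = 1) * x i) = x 1" for x :: "nat \<Rightarrow> real"
    using n by (subst sum.remove[of _ 1]) (auto intro: sum.neutral)
  have "linear_threshold {1..n} ?f"
    unfolding linear_threshold_def
  proof (intro exI[of _ "\<lambda>i. of_bool (i = 1)"] ballI conjI refl)
    fix x assume "x \<in> sign_cube {1..n}"
    then show "(\<Sum>i\<in>{1..n}. of_bool (i = 1) * x i) \<noteq> 0"
      unfolding first using sign_cubeD[of x "{1..n}" 1] n by auto
  qed
  moreover have "1 / 3584 * real n \<le> PP_xor {1..n} ?f"
    by (rule order.trans[OF _ PP_xor_ge_1]) (use True in simp)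
  ultimately show ?thesis by blast
next
  case False
  define k where "k = (n - 1) div 64"
  have k: "1 \<le> k" "64 * k < n" "n \<le> 64 * k + 64" using False unfolding k_def by linarith+
  then obtain f where f: "linear_threshold {1..n} f" "real k / 2 - 13 \<le> PP_xor {1..n} f"
    using exists_hard_halfspace by blast
  have "real k / 28 \<le> PP_xor {1..n} f"
    by (rule linear_bound_of_affine_bound[OF PP_xor_ge_1 f(2)])
  \<comment> \<open>Here \<open>n \<le> 64 * k + 64 \<le> 128 * k\<close>, and
    \<open>3584 = 128 * 28\<close>.\<close>
  moreover have "1 / 3584 * real n \<le> real k / 28" using k by simp
  ultimately show ?thesis using f(1) by (intro exI[of _ f]) linarith
qed

subsection \<open>The universal threshold function\<close>

text \<open>A positive cosine confines \<open>x\<close> to \<open>pi / 2\<close> in absolute value,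
  so \<open>2 * x\<close> is again within \<open>pi\<close> and the argument repeats.\<close>

lemma cos_doubling_small:
  "\<bar>x\<bar> \<le> pi \<Longrightarrow> \<forall>i<k. 0 < cos (2 ^ i * x) \<Longrightarrow> \<bar>x\<bar> \<le> pi / 2 ^ k" for x :: real
proof (induction k arbitrary: x)
  case (Suc k)
  have "\<bar>x\<bar> \<le> pi / 2"
  proof (rule ccontr)
    assume "\<not> \<bar>x\<bar> \<le> pi / 2"
    then have "cos \<bar>x\<bar> \<le> cos (pi / 2)" using Suc.prems(1) by (intro cos_monotone_0_pi_le) auto
    moreover have "0 < cos (2 ^ 0 * x)" using Suc.prems(2) by blast
    ultimately show False by simp
  qed
  then have "\<bar>2 * x\<bar> \<le> pi" by simp
  moreover have "0 < cos (2 ^ i * (2 * x))" if "i < k" for i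
  proof -
    have "0 < cos (2 ^ Suc i * x)" using Suc.prems(2) that by blast
    then show ?thesis by (simp add: mult_ac)
  qed
  ultimately have "\<bar>2 * x\<bar> \<le> pi / 2 ^ k" by (intro Suc.IH) auto
  then show ?case by simp
qed simp

text \<open>Reduced to absolute value at most \<open>pi\<close>, the angle of a far residue is at
  least \<open>2 * pi / 2 ^ k\<close> in absolute value, too large for all \<open>k\<close>
  doublings to have positive cosine.\<close>

lemma far_residue_cos_nonpos:
  assumes R: "1 \<le> R" and Q: "Q = 2 ^ k * R" and far: "far_residue R Q a"
  shows "\<exists>i<k. cos (2 * pi * real a * real (2 ^ i) / real Q) \<le> 0"
proof (rule ccontr)
  assume "\<not> ?thesis"
  then have pos: "\<forall>i<k. 0 < cos (2 * pi * real a * real (2 ^ i) / real Q)" by auto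
  let ?r = "a mod Q"
  have Q0: "0 < Q" using R unfolding Q by simp
  have RQ: "real R / real Q = 1 / 2 ^ k" using R unfolding Q by simp
  have r: "real R \<le> real ?r" "real ?r + real R \<le> real Q"
    using far unfolding far_residue_def by (metis of_nat_add of_nat_le_iff)+
  \<comment> \<open>The representative of \<open>a\<close> modulo \<open>Q\<close> of least absolute
    value.\<close>
  define s where "s = (if 2 * real ?r \<le> real Q then real ?r else real ?r - real Q)"
  have s: "real R \<le> \<bar>s\<bar>" "\<bar>s\<bar> \<le> real Q / 2" using r unfolding s_def by auto
  define x where "x = 2 * pi * s / real Q"
  have cis: "cis (2 * pi * real a / real Q) = cis x"
  proof (cases "2 * real ?r \<le> real Q")
    case True
    then show ?thesis unfolding cis_mod_nat[OF Q0, of a] x_def s_def by simp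
  next
    case False
    have "2 * pi * real ?r / real Q = 2 * pi * (real ?r - real Q) / real Q + 2 * pi"
      using Q0 by (simp add: field_simps)
    with False show ?thesis
      unfolding cis_mod_nat[OF Q0, of a] x_def s_def by (simp flip: cis_mult)
  qed
  have abs_x: "\<bar>x\<bar> = 2 * pi * (\<bar>s\<bar> / real Q)" unfolding x_def by (simp add: abs_mult)
  have "\<bar>x\<bar> \<le> 2 * pi * (1 / 2)"
    unfolding abs_x using s(2) Q0 by (intro mult_left_mono) (auto simp: field_simps)
  moreover have "0 < cos (2 ^ i * x)" if "i < k" for i
  proof -
    have "cos (2 * pi * real a * real (2 ^ i) / real Q) = Re (cis (2 * pi * real a / real Q) ^ (2 ^ i))"
      by (simp add: Complex.DeMoivre mult_ac)
    also have "\<dots> = cos (2 ^ i * x)" unfolding cis by (simp add: Complex.DeMoivre)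
    finally show ?thesis using pos[rule_format, OF that] by simp
  qed
  ultimately have "\<bar>x\<bar> \<le> pi / 2 ^ k" by (intro cos_doubling_small) auto
  moreover have "2 * pi * (1 / 2 ^ k) \<le> \<bar>x\<bar>"
    unfolding abs_x RQ[symmetric] using s(1) by (intro mult_left_mono divide_right_mono) auto
  moreover have "0 < pi / 2 ^ k" by simp
  ultimately show False by simp
qed

text \<open>For every far \<open>a\<close> some weight \<open>2 ^ i\<close> has a nonpositive
  cosine. Its \<open>64 * k\<close> copies contribute at most \<open>15 / 16\<close> each, and all
  other factors are at most 1. Rows are numbered from 1, so this weight sits in row
  \<open>Suc i\<close>.\<close>

lemma binary_weights_far_sum:
  assumes R: "1 \<le> R" and Q: "Q = 2 ^ k * R"
  shows "(\<Sum>a | a < 4 * Q \<and> far_residue R Q a. \<Prod>p\<in>{1..k} \<times> {1..64 * k}.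
      (15 + cos (2 * pi * real a * real (2 ^ (fst p - 1)) / real Q)) / 16) \<le> 4 * real Q * (1 / 4 ^ k)"
    (is "sum ?P ?F \<le> _")
proof -
  have "?P a \<le> 1 / 4 ^ k" if a: "a \<in> ?F" for a
  proof -
    let ?A = "{1..k} \<times> {1..64 * k}"
    let ?c = "\<lambda>i. cos (2 * pi * real a * real (2 ^ i) / real Q)"
    obtain i where i: "i < k" "?c i \<le> 0"
      using far_residue_cos_nonpos[OF R Q, of a] a by auto
    have "?P a \<le> (\<Prod>p\<in>?A. if fst p = Suc i then 15 / 16 else 1)"
    proof (intro prod_mono conjI)
      fix p assume "p \<in> ?A"
      have "0 \<le> 15 + ?c j" "15 + ?c j \<le> 16" for j
        using cos_ge_minus_one[of "2 * pi * real a * real (2 ^ j) / real Q"]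
          cos_le_one[of "2 * pi * real a * real (2 ^ j) / real Q"] by linarith+
      then show "0 \<le> (15 + ?c (fst p - 1)) / 16"
        "(15 + ?c (fst p - 1)) / 16 \<le> (if fst p = Suc i then 15 / 16 else 1)"
        using i(2) by auto
    qed
    also have "\<dots> = (15 / 16) ^ card (?A \<inter> {p. fst p = Suc i})"
      by (subst prod.If_cases) auto
    also have "?A \<inter> {p. fst p = Suc i} = {Suc i} \<times> {1..64 * k}" using i by auto
    also have "(15 / 16) ^ card \<dots> = ((15 / 16 :: real) ^ 64) ^ k"
      by (simp add: card_cartesian_product power_mult)
    also have "\<dots> \<le> (1 / 4) ^ k" by (intro power_mono) (simp_all add: field_simps)
    finally show ?thesis by (simp add: power_divide)
  qed
  then have "sum ?P ?F \<le> of_nat (card ?F) * (1 / 4 ^ k)" by (rule sum_bounded_above)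
  also have "\<dots> \<le> 4 * real Q * (1 / 4 ^ k)"
  proof (rule mult_right_mono)
    have "card ?F \<le> card {..<4 * Q}" by (rule card_mono) auto
    then have "real (card ?F) \<le> real (4 * Q)" unfolding of_nat_le_iff by simp
    then show "real (card ?F) \<le> 4 * real Q" by simp
  qed simp
  finally show ?thesis .
qed

lemma sum_alternating_signs: "(\<Sum>j = 2 * p + 1..2 * p + 2 * d. (- 1) ^ j :: real) = 0"
  by (induction d) auto

text \<open>The active variables are the first \<open>64 * k\<close> columns of the first
  \<open>k\<close> rows. With the rest fixed, the form of \<open>uthr\<close> is twice the distance
  of \<open>?V\<close> from the popular level, so the additive \<open>1 / 2\<close> puts the
  threshold just below that level. The condition on \<open>m\<close> leaves room for a second block
  of \<open>64 * k\<close> columns.\<close>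

lemma uthr_PP_lower_bound:
  assumes k: "1 \<le> k" and m: "32 * k \<le> m"
  shows "real k / 2 - 13 \<le> PP_xor (uthr_index (4 * m) m) (uthr (4 * m) m)"
proof -
  let ?I = "uthr_index (4 * m) m" and ?A = "{1..k} \<times> {1..64 * k}"
  let ?u = "\<lambda>p :: nat \<times> nat. 2 ^ (fst p - 1) :: nat"
  let ?V = "linear_form ?A ?u"
  define R where "R = 64 * k * 2 ^ k"
  define Q where "Q = 2 ^ k * R"
  have R1: "1 \<le> R" using k by (simp add: R_def)
  have AI: "?A \<subseteq> ?I" using m by (auto simp: uthr_index_def)
  have I: "finite ?I" by (simp add: uthr_index_def)
  have uR: "sum ?u ?A \<le> R"
  proof -
    have "sum ?u ?A = (\<Sum>i\<in>{1..k}. \<Sum>j\<in>{1..64 * k}. 2 ^ (i - 1))"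
      by (simp only: sum.cartesian_product split_def)
    also have "\<dots> = 64 * k * (\<Sum>i\<in>{1..k}. 2 ^ (i - 1))"
      by (simp add: sum_distrib_left)
    also have "(\<Sum>i\<in>{1..k}. 2 ^ (i - 1)) \<le> (2 ^ k :: nat)"
      by (induction k) auto
    finally show ?thesis by (simp add: R_def)
  qed
  obtain z1 where z1: "z1 \<in> sign_cube ?A"
    "2 ^ card ?A \<le> (2 * R + 1) * card {z\<in>sign_cube ?A. ?V z = ?V z1}"
    using exists_popular_level[OF _ uR] by auto
  \<comment> \<open>The columns after the active ones subtract the popular level; all others cancel in pairs.\<close>
  define c where "c = (\<lambda>p\<in>?I. case p of (i, j) \<Rightarrow>
    if i \<le> k \<and> 64 * k < j \<and> j \<le> 128 * k then - z1 (i, j - 64 * k) else (- 1) ^ j)"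
  have pm: "z1 (i, j - 64 * k) = - 1 \<or> z1 (i, j - 64 * k) = 1"
    if "1 \<le> i" "i \<le> k" "64 * k < j" "j \<le> 128 * k" for i j
  proof (rule sign_cubeD[OF z1(1)])
    have "1 \<le> j - 64 * k" "j - 64 * k \<le> 64 * k" using that by linarith+
    then show "(i, j - 64 * k) \<in> ?A" using that by simp
  qed
  have c: "c \<in> sign_cube ?I"
    unfolding sign_cube_def c_def
  proof (rule restrict_PiE_iff[THEN iffD2], rule ballI)
    fix p assume p: "p \<in> ?I"
    obtain i j where ij: "p = (i, j)" by (cases p)
    have "(- 1 :: real) ^ j \<in> {- 1, 1}" by (cases "even j") auto
    with pm[of i j] p show "(case p of (i, j) \<Rightarrow> if i \<le> k \<and> 64 * k < j \<and> j \<le> 128 * k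
        then - z1 (i, j - 64 * k) else (- 1) ^ j) \<in> {- 1, 1}"
      unfolding ij by (auto simp: uthr_index_def)
  qed
  have form: "(\<Sum>i = 1..m. \<Sum>j = 1..4 * m. 2 ^ i * z (i, j)) = 2 * (?V z - ?V z1)"
    if z: "\<forall>p\<in>?I - ?A. z p = c p" for z
  proof -
    have row: "(\<Sum>j = 1..4 * m. z (i, j))
        = (if i \<le> k then (\<Sum>j = 1..64 * k. z (i, j)) - (\<Sum>j = 1..64 * k. z1 (i, j)) else 0)"
      if i: "i \<in> {1..m}" for i
    proof (cases "i \<le> k")
      case True
      \<comment> \<open>Half the number of padding columns behind the two blocks; this number is
        even, so the alternating signs cancel.\<close>
      define d where "d = 2 * m - 64 * k"
      have len: "4 * m = 64 * k + (64 * k + 2 * d)" using m by (simp add: d_def)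
      have zc: "z (i, j) = (if j \<le> 128 * k then - z1 (i, j - 64 * k) else (- 1) ^ j)"
        if "64 * k < j" "j \<le> 4 * m" for j
      proof -
        have "(i, j) \<in> ?I - ?A" using i that by (auto simp: uthr_index_def)
        then have "z (i, j) = c (i, j)" "(i, j) \<in> ?I" using z by auto
        then show ?thesis using True that(1) by (simp add: c_def)
      qed
      have "(\<Sum>j = 1..4 * m. z (i, j)) = (\<Sum>j = 1..64 * k. z (i, j))
          + ((\<Sum>j = 64 * k + 1..64 * k + 64 * k. z (i, j))
          + (\<Sum>j = 64 * k + 64 * k + 1..64 * k + 64 * k + 2 * d. z (i, j)))"
        unfolding len sum.ub_add_nat[of 1 "64 * k" "\<lambda>j. z (i, j)" "64 * k + 2 * d", OF le_add2]
        by (subst sum.ub_add_nat[of "64 * k + 1" "64 * k + 64 * k" _ "2 * d", symmetric]) (simp_all add: add.assoc)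
      also have "(\<Sum>j = 64 * k + 1..64 * k + 64 * k. z (i, j)) = - (\<Sum>j = 1..64 * k. z1 (i, j))"
      proof -
        have "(\<Sum>j = 64 * k + 1..64 * k + 64 * k. z (i, j))
            = (\<Sum>j = 64 * k + 1..64 * k + 64 * k. - z1 (i, j - 64 * k))"
          by (rule sum.cong) (use len in \<open>auto simp: zc\<close>)
        also have "\<dots> = (\<Sum>j = 1..64 * k. - z1 (i, j))"
          using sum.shift_bounds_cl_nat_ivl[of "\<lambda>j. - z1 (i, j - 64 * k)" 1 "64 * k" "64 * k"]
          by (simp add: add.commute)
        finally show ?thesis by (simp add: sum_negf)
      qed
      also have "(\<Sum>j = 64 * k + 64 * k + 1..64 * k + 64 * k + 2 * d. z (i, j))
          = (\<Sum>j = 2 * (64 * k) + 1..2 * (64 * k) + 2 * d. (- 1) ^ j)"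
        by (rule sum.cong) (use len in \<open>auto simp: zc\<close>)
      finally show ?thesis using True sum_alternating_signs[of "64 * k" d] by simp
    next
      case False
      have "(\<Sum>j = 1..4 * m. z (i, j)) = (\<Sum>j = 2 * 0 + 1..2 * 0 + 2 * (2 * m). (- 1) ^ j)"
      proof (rule sum.cong)
        fix j assume "j \<in> {2 * 0 + 1..2 * 0 + 2 * (2 * m)}"
        then have "(i, j) \<in> ?I" "(i, j) \<in> ?I - ?A" using i False by (auto simp: uthr_index_def)
        then have "z (i, j) = c (i, j)" "(i, j) \<in> ?I" using z by auto
        then show "z (i, j) = (- 1) ^ j" using False by (simp add: c_def)
      qed simp
      also have "\<dots> = 0" by (rule sum_alternating_signs)
      finally show ?thesis using False by simp
    qed
    \<comment> \<open>Row \<open>i\<close> has weight \<open>2 ^ i\<close> in \<open>uthr\<close>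
      but \<open>2 ^ (i - 1)\<close> in \<open>?V\<close>, hence the factor 2.\<close>
    have V: "2 * ?V y = (\<Sum>i = 1..k. 2 ^ i * (\<Sum>j = 1..64 * k. y (i, j)))" for y
    proof -
      have "2 * ?V y = (\<Sum>i = 1..k. \<Sum>j = 1..64 * k. 2 * (real (2 ^ (i - 1)) * y (i, j)))"
        unfolding linear_form_def sum_distrib_left by (simp only: sum.cartesian_product split_def) simp
      also have "\<dots> = (\<Sum>i = 1..k. 2 ^ i * (\<Sum>j = 1..64 * k. y (i, j)))"
      proof (rule sum.cong[OF refl])
        fix i assume "i \<in> {1..k}"
        then have "(2::real) ^ i = 2 * 2 ^ (i - 1)" by (simp flip: power_Suc)
        then show "(\<Sum>j = 1..64 * k. 2 * (real (2 ^ (i - 1)) * y (i, j)))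
            = 2 ^ i * (\<Sum>j = 1..64 * k. y (i, j))"
          by (simp add: sum_distrib_left mult.assoc)
      qed
      finally show ?thesis .
    qed
    have "(\<Sum>i = 1..m. \<Sum>j = 1..4 * m. 2 ^ i * z (i, j)) = (\<Sum>i = 1..m. 2 ^ i * (\<Sum>j = 1..4 * m. z (i, j)))"
      by (simp only: sum_distrib_left)
    also have "\<dots> = (\<Sum>i = 1..m. if i \<in> {1..k} then
        2 ^ i * ((\<Sum>j = 1..64 * k. z (i, j)) - (\<Sum>j = 1..64 * k. z1 (i, j))) else 0)"
      by (rule sum.cong[OF refl]) (simp only: row, simp)
    also have "\<dots> = (\<Sum>i = 1..k. 2 ^ i * ((\<Sum>j = 1..64 * k. z (i, j)) - (\<Sum>j = 1..64 * k. z1 (i, j))))"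
      by (rule sum.mono_neutral_cong_right) (use m in auto)
    also have "\<dots> = 2 * ?V z - 2 * ?V z1"
      unfolding V by (simp only: right_diff_distrib sum_subtractf)
    finally show ?thesis by (simp only: right_diff_distrib)
  qed
  show ?thesis
  proof (rule PP_xor_ge_of_subcube[OF I AI c z1(1) k R_def uR Q_def _ z1(2)])
    show "(\<Sum>a | a < 4 * Q \<and> far_residue R Q a. \<Prod>p\<in>?A.
        (15 + cos (2 * pi * real a * real (?u p) / real Q)) / 16) \<le> 4 * real Q * (1 / 4 ^ k)"
      by (rule binary_weights_far_sum[OF R1 Q_def])
    fix z assume z: "\<forall>i\<in>?I - ?A. z i = c i"
    show "?V z = ?V z1 \<Longrightarrow> uthr (4 * m) m z = 1" "?V z = ?V z1 - 4 \<Longrightarrow> uthr (4 * m) m z = - 1"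
      unfolding uthr_def form[OF z] by simp_all
  qed
qed

lemma GHR_PP_lower_bound:
  "(\<lambda>m. PP_xor (uthr_index (4 * m) m) (uthr (4 * m) m))
      \<in> \<Omega>(\<lambda>m. sqrt (real (card (uthr_index (4 * m) m))))"
proof (rule landau_omega.bigI[where c = "1 / 3528"])
  show "\<forall>\<^sub>F m in at_top. 1 / 3528 * norm (sqrt (real (card (uthr_index (4 * m) m))))
      \<le> norm (PP_xor (uthr_index (4 * m) m) (uthr (4 * m) m))"
    using eventually_ge_at_top[of 32]
  proof eventually_elim
    case (elim m)
    define k where "k = m div 32"
    have k: "1 \<le> k" "32 * k \<le> m" "m \<le> 32 * k + 31" using elim unfolding k_def by linarith+
    have "real (card (uthr_index (4 * m) m)) = (2 * real m)\<^sup>2"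
      by (simp add: uthr_index_def card_cartesian_product power2_eq_square)
    then have "sqrt (real (card (uthr_index (4 * m) m))) = 2 * real m" by (simp only: real_sqrt_abs abs_mult abs_numeral abs_of_nat)
    moreover have "real k / 28 \<le> PP_xor (uthr_index (4 * m) m) (uthr (4 * m) m)"
      by (rule linear_bound_of_affine_bound[OF PP_xor_ge_1 uthr_PP_lower_bound[OF k(1,2)]])
    \<comment> \<open>The number of variables is \<open>4 * m^2\<close>, with root
      \<open>2 * m\<close>. Since \<open>m \<le> 32 * k + 31 \<le> 63 * k\<close>, the constant is
      \<open>1 / (126 * 28)\<close>.\<close>
    moreover have "1 / 3528 * (2 * real m) \<le> real k / 28" using k by simp
    ultimately show ?case by simp
  qed
qed simp

theorem mainTheorem6:
  "(\<exists>c::real. c > 0 \<and>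
      (\<forall>n::nat. n \<ge> 1 \<longrightarrow>
        (\<exists>f :: (nat \<Rightarrow> real) \<Rightarrow> real.
           linear_threshold {1..n} f \<and> PP_xor {1..n} f \<ge> c * real n))) \<and>
   (\<lambda>m::nat. PP_xor (uthr_index (4 * m) m) (uthr (4 * m) m))
      \<in> \<Omega>(\<lambda>m. sqrt (real (card (uthr_index (4 * m) m))))"
proof
  show "\<exists>c::real. c > 0 \<and> (\<forall>n::nat. n \<ge> 1 \<longrightarrow>
        (\<exists>f :: (nat \<Rightarrow> real) \<Rightarrow> real. linear_threshold {1..n} f \<and> PP_xor {1..n} f \<ge> c * real n))"
    using linear_PP_lower_bound by (intro exI[of _ "1 / 3584"]) auto
qed (rule GHR_PP_lower_bound)

end
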